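(* Let $f:\mathbb{R}\to\mathbb{C}$ be in either $L^1(\mathbb{R})$ or $L^2(\mathbb{R})$, and let $w\in\mathbb{C}$ with $\operatorname{Re}(w)>-1$. Then $$\int_{-\infty}^{\infty}\binom{w}{x} f(x)\,dx=\sum_{k=0}^{\infty}\binom{w}{k}\int_{-1/2}^{1/2}\widehat{f}(\xi)\,e^{2\pi i \xi k}\,d\xi .$$
   Context: For $w\in\mathbb{C}$ not a negative integer and $z\in\mathbb{C}$, the generalized binomial coefficient is $\binom{w}{z}=\frac{\Gamma(w+1)}{\Gamma(z+1)\Gamma(w-z+1)}$, where the reciprocal gamma function $1/\Gamma$ is understood as an entire function (equal to $0$ at the nonpositive integers). For an integer $k\ge 1$ one has $\binom{w}{k}=\frac{w(w-1)\cdots(w-k+1)}{k!}$, and $\binom{w}{0}=1$. The Fourier transform of $f\in L^1(\mathbb{R})+L^2(\mathbb{R})$ is $\widehat{f}(\xi)=\int_{-\infty}^{\infty} f(x)e^{-2\pi i x\xi}\,dx$; if $f\in L^2(\mathbb{R})$ this expression is understood as an improper integral (the usual $L^2$ Fourier transform).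
   Formalization: For f in L² but not in L¹, Re(w) > -1/2 is assumed instead of Re(w) > -1; otherwise the claim fails, e.g. for w = -0.7 and f(x) = binom(-0.4, x) the series on the right diverges. *)

theory Defs
  imports "HOL-Analysis.Analysis"
begin

definition gen_binomial :: "complex \<Rightarrow> complex \<Rightarrow> complex" where
  "gen_binomial w z = Gamma (w + 1) * rGamma (z + 1) * rGamma (w - z + 1)"

definition L2_fun :: "(real \<Rightarrow> complex) \<Rightarrow> bool" where
  "L2_fun f \<longleftrightarrow> f \<in> borel_measurable lebesgue \<and> integrable lebesgue (\<lambda>x. (norm (f x))\<^sup>2)"

definition fourier_integral :: "(real \<Rightarrow> complex) \<Rightarrow> real \<Rightarrow> complex" where
  "fourier_integral f \<xi> =
     (LINT x|lebesgue. f x * exp (- 2 * of_real pi * \<i> * of_real x * of_real \<xi>))"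

(* The improper integral defining the L2 transform: the limit, in the L2 norm with respect to
   the frequency variable, of the integrals over [-R, R].  The squared distance is taken as a
   nonnegative integral because the Bochner integral of a non-integrable function is 0. *)
definition has_L2_fourier :: "(real \<Rightarrow> complex) \<Rightarrow> (real \<Rightarrow> complex) \<Rightarrow> bool" where
  "has_L2_fourier f g \<longleftrightarrow> L2_fun g \<and>
     ((\<lambda>R::real. \<integral>\<^sup>+ \<xi>. ennreal ((norm
          (g \<xi> - fourier_integral (\<lambda>x. indicator {-R..R} x *\<^sub>R f x) \<xi>))\<^sup>2) \<partial>lebesgue)
       \<longlongrightarrow> 0) at_top"

(* For f in L2 but not in L1 the transform is only determined almost everywhere, so an arbitrary
   representative is chosen.  On the intersection of L1 and L2 the two cases agree almost
   everywhere. *)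
definition fourier :: "(real \<Rightarrow> complex) \<Rightarrow> real \<Rightarrow> complex" where
  "fourier f = (if integrable lebesgue f then fourier_integral f
                else (SOME g. has_L2_fourier f g))"

end

(* The inverse Fourier transform of the indicator of [-1/2, 1/2] is the sinc kernel, so the
   k-th integral on the right equals the integral of f(x) sinc(x - k), and the theorem reduces
   to integrating the expansion of binom(w, x) as the sum over k of binom(w, k) sinc(x - k).
   For non-integer x the expansion is the partial fraction expansion
     Gamma(w+1) Gamma(r) / Gamma(w+1+r) = sum_k (-1)^k binom(w, k) / (r + k),   r = -x,
   combined with the reflection formula.  The binomials decay like k^-(Re w + 1), so the partial
   sums are dominated by (1 + |x|)^-b for every 0 <= b < min(Re w + 1, 1): b = 0 suffices for
   f in L1, and some b > 1/2, which requires Re w > -1/2, for f in L2.  In the L2 case the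
   transform exists by Plancherel's inequality and completeness. *)
theory Submission
  imports Defs "HOL-Probability.Characteristic_Functions"
begin

text \<open>The Gamma quotient in the partial fraction expansion is the Beta value B(r, w+1),
  formally the termwise integral of t^(r-1) (1-t)^w over [0,1]. In this reading
  \<open>inverse_diff n r\<close> is B(r, n+1) and \<open>S n r\<close> is B(r, w+n+1): differencing
  in r inserts a factor 1-t, and the shift recurrence is the functional equation of Beta in its
  first argument. Comparing the two for large n replaces the integral by a limit, and running the
  recurrence backwards reaches negative r, where the integral diverges.

  The condition Re w > -1/2 outside L1 reflects the kernel itself: as x tends to infinity, binom(w,
  x) behaves like x^-(Re w + 1) times an oscillating factor that does not decay, unless w is a
  natural number. For Re w <= -1/2 it is therefore not in L2, and some f in L2 has a product with it
  that is not integrable.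

  An L2 transform is an arbitrary representative. Integration against a character of the band
  [-1/2, 1/2] is a contraction from L2 to the complex numbers, so every representative gives the
  same value, namely the limit of the values for truncations of f.\<close>

section \<open>Decay of the binomial coefficients and estimates of the dominating sums\<close>

text \<open>Dividing by the asymptotic size leaves a convergent, hence bounded, sequence. The base 1
  + k in place of k makes the bound usable at k = 0.\<close>

lemma norm_gbinomial_le_powr:
  fixes w :: complex
  assumes "Re w > -1"
  obtains C where "C > 0" "\<And>k. norm (w gchoose k) \<le> C * (1 + real k) powr (-(Re w + 1))"
proof -
  define a where "a = Re w + 1"
  have a: "a > 0" using assms by (simp add: a_def)
  define X where "X = (\<lambda>n. (w gchoose n) / ((-1)^n / exp ((w+1) * of_real (ln (real n)))))"
  have "X \<longlonglongrightarrow> inverse (Gamma (- w))"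
    unfolding X_def by (rule gbinomial_asymptotic)
  hence "Bseq X" by (intro convergent_imp_Bseq convergentI)
  then obtain B where B: "B > 0" "\<And>n. norm (X n) \<le> B" by (auto simp: Bseq_def)
  have nX: "norm (X n) = norm (w gchoose n) * exp (a * ln (real n))" for n
    by (simp add: X_def norm_divide norm_power norm_mult a_def)
  \<comment> \<open>The summand 1 covers k = 0; the factor \<open>2 powr a\<close> pays for
    replacing k by the smaller (1 + k)/2 when k >= 1.\<close>
  have "norm (w gchoose k) \<le> (1 + B * 2 powr a) * (1 + real k) powr (-a)" for k
  proof (cases "k = 0")
    case True thus ?thesis using B a by simp
  next
    case False
    hence k: "real k \<ge> 1" by simp
    have "norm (w gchoose k) * real k powr a \<le> B"
      using B(2)[of k] False unfolding nX powr_def by (simp add: mult.commute)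
    hence "norm (w gchoose k) \<le> B * real k powr (-a)"
      using k by (simp add: powr_minus field_simps)
    also have "real k powr (-a) \<le> ((1 + real k) / 2) powr (-a)"
      using k a by (intro powr_mono2') auto
    also have "\<dots> = 2 powr a * (1 + real k) powr (-a)"
      by (simp add: powr_divide powr_minus field_simps)
    finally have "norm (w gchoose k) \<le> B * 2 powr a * (1 + real k) powr (-a)"
      using B by (simp add: mult.assoc)
    also have "\<dots> \<le> (1 + B * 2 powr a) * (1 + real k) powr (-a)"
      by (intro mult_right_mono) auto
    finally show ?thesis .
  qed
  moreover have "1 + B * 2 powr a > 0" using B by (simp add: add_pos_pos)
  ultimately show ?thesis using that a_def by blast
qed

text \<open>The indices are split at a natural number m near x. On each side the distances from m
  are pairwise distinct, so each half is a partial sum of the convergent series over (1 + j)^-p,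
  whatever x is.\<close>

lemma sum_shifted_powr_bounded:
  fixes p :: real
  assumes "p > 1"
  obtains M where "M > 0" "\<And>x N. (\<Sum>k<N. (1 + \<bar>x - real k\<bar>) powr (-p)) \<le> M"
proof -
  define g where "g = (\<lambda>j. (1 + real j) powr (-p))"
  have "summable (\<lambda>j. real j powr (-p))" using assms by (simp add: summable_real_powr_iff)
  hence "summable (\<lambda>j. real (Suc j) powr (-p))" by (subst summable_Suc_iff)
  hence sg: "summable g" by (simp add: g_def add.commute)
  have g0: "g j \<ge> 0" for j by (simp add: g_def)
  have bound: "(\<Sum>k<N. (1 + \<bar>x - real k\<bar>) powr (-p)) \<le> 2 powr p * (2 * suminf g)" for x N
  proof -
    \<comment> \<open>For x >= 0 the distance from k to m exceeds the distance to x by at most 1,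
      which gives the factor 2 below. For x < 0 one has m = 0, and m is closer to every k than x
      is.\<close>
    define m where "m = nat \<lfloor>x\<rfloor>"
    define d where "d k = nat \<bar>int m - int k\<bar>" for k
    have d: "1 + real (d k) \<le> 2 * (1 + \<bar>x - real k\<bar>)" for k
    proof -
      have "real (d k) = \<bar>real m - real k\<bar>" by (simp add: d_def)
      moreover have "(real m \<le> x \<and> x < real m + 1) \<or> (x < 0 \<and> m = 0)"
        unfolding m_def by linarith
      ultimately show ?thesis by (auto simp: abs_if)
    qed
    have "(1 + \<bar>x - real k\<bar>) powr (-p) \<le> 2 powr p * g (d k)" for k
    proof -
      have "(1 + \<bar>x - real k\<bar>) powr (-p) \<le> ((1 + real (d k)) / 2) powr (-p)"
        using assms d[of k] by (intro powr_mono2') auto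
      also have "\<dots> = 2 powr p * g (d k)"
        by (simp add: g_def powr_divide powr_minus field_simps)
      finally show ?thesis .
    qed
    hence "(\<Sum>k<N. (1 + \<bar>x - real k\<bar>) powr (-p)) \<le> (\<Sum>k<N. 2 powr p * g (d k))"
      by (intro sum_mono)
    also have "\<dots> = 2 powr p * (\<Sum>k<N. g (d k))" by (simp add: sum_distrib_left)
    also have "(\<Sum>k<N. g (d k)) = (\<Sum>k\<in>{..<N} \<inter> {..m}. g (d k)) + (\<Sum>k\<in>{..<N} - {..m}. g (d k))"
      by (subst sum.union_disjoint [symmetric]) (auto intro: sum.cong)
    also have "(\<Sum>k\<in>{..<N} \<inter> {..m}. g (d k)) = sum g (d ` ({..<N} \<inter> {..m}))"
      by (subst sum.reindex) (auto simp: inj_on_def d_def)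
    also have "\<dots> \<le> suminf g" by (intro sum_le_suminf sg) (auto simp: g0)
    also have "(\<Sum>k\<in>{..<N} - {..m}. g (d k)) = sum g (d ` ({..<N} - {..m}))"
      by (subst sum.reindex) (auto simp: inj_on_def d_def)
    also have "\<dots> \<le> suminf g" by (intro sum_le_suminf sg) (auto simp: g0)
    finally show ?thesis by simp
  qed
  show ?thesis
  proof (rule that[of "2 powr p * (2 * suminf g) + 1"])
    have "suminf g \<ge> 0" by (intro suminf_nonneg sg g0)
    thus "2 powr p * (2 * suminf g) + 1 > 0"
      by (intro add_nonneg_pos mult_nonneg_nonneg) auto
  qed (use bound in \<open>auto intro: order_trans[OF bound]\<close>)
qed

text \<open>Both exponents are nonpositive, so replacing the larger base by the smaller one
  increases the product. This decouples the factors in k and in x - k, leaving two sums of one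
  kind.\<close>

lemma powr_mult_powr_le_add:
  fixes u v s t :: real
  assumes "u \<ge> 1" "v \<ge> 1" "s \<ge> 0" "t \<ge> 0"
  shows "u powr (-s) * v powr (-t) \<le> u powr (-(s+t)) + v powr (-(s+t))"
proof (cases "u \<le> v")
  case True
  have "u powr (-s) * v powr (-t) \<le> u powr (-s) * u powr (-t)"
    using assms True by (intro mult_left_mono powr_mono2') auto
  also have "\<dots> = u powr (-(s+t))" using assms by (simp add: powr_add [symmetric])
  finally show ?thesis by (simp add: add_increasing2)
next
  case False
  have "u powr (-s) * v powr (-t) \<le> v powr (-s) * v powr (-t)"
    using assms False by (intro mult_right_mono powr_mono2') auto
  also have "\<dots> = v powr (-(s+t))" using assms by (simp add: powr_add [symmetric])
  finally show ?thesis by (simp add: add_increasing)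
qed

text \<open>The weight (1 + |x|)^b is moved to the left: since 1 + |x| is at most twice the larger
  of u = 1 + k and v = 1 + |x - k|, it can be charged to u or to v. The exponents a - b and 1 - b
  that remain are nonnegative by hypothesis.\<close>

lemma sum_powr_mult_inverse_le_powr:
  fixes a b :: real
  assumes "0 \<le> b" "b < a" "b < 1"
  obtains M where "M > 0"
    "\<And>x N. (\<Sum>k<N. (1 + real k) powr (-a) * (1 / (1 + \<bar>x - real k\<bar>))) \<le> M * (1 + \<bar>x\<bar>) powr (-b)"
proof -
  \<comment> \<open>The total exponent a + 1 of the product, less the b spent on the weight; b < a
    is exactly q > 1.\<close>
  define q where "q = a + 1 - b"
  have "q > 1" using assms by (simp add: q_def)
  then obtain M where M: "M > 0" "\<And>x N. (\<Sum>k<N. (1 + \<bar>x - real k\<bar>) powr (-q)) \<le> M"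
    by (rule sum_shifted_powr_bounded) blast
  have term_le: "(1 + real k) powr (-a) * (1 / (1 + \<bar>x - real k\<bar>)) * (1 + \<bar>x\<bar>) powr b
      \<le> 4 * ((1 + real k) powr (-q) + (1 + \<bar>x - real k\<bar>) powr (-q))" for k x
  proof -
    define u where "u = 1 + real k"
    define v where "v = 1 + \<bar>x - real k\<bar>"
    have uv: "u \<ge> 1" "v \<ge> 1" by (auto simp: u_def v_def)
    have "1 + \<bar>x\<bar> \<le> 2 * max u v"
      unfolding u_def v_def max_def abs_if by (auto split: if_splits)
    hence "(1 + \<bar>x\<bar>) powr b \<le> (2 * max u v) powr b"
      using assms by (intro powr_mono2) auto
    also have "\<dots> = 2 powr b * max u v powr b" using uv by (simp add: powr_mult)
    also have "\<dots> \<le> 2 * max u v powr b"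
      using assms powr_mono[of b 1 2] by (intro mult_right_mono) auto
    also have "max u v powr b \<le> u powr b + v powr b"
      by (cases "u \<le> v") (auto simp: max_def)
    finally have x: "(1 + \<bar>x\<bar>) powr b \<le> 2 * (u powr b + v powr b)" by simp
    have "u powr (-a) * (1 / v) * (1 + \<bar>x\<bar>) powr b
      \<le> u powr (-a) * (1 / v) * (2 * (u powr b + v powr b))"
      using uv by (intro mult_left_mono x) auto
    also have "\<dots> = 2 * (u powr (-(a-b)) * v powr (-1) + u powr (-a) * v powr (-(1-b)))"
      using uv by (simp add: powr_diff powr_minus field_simps)
    also have "\<dots> \<le> 2 * ((u powr (-q) + v powr (-q)) + (u powr (-q) + v powr (-q)))"
      using powr_mult_powr_le_add[of u v "a-b" 1] powr_mult_powr_le_add[of u v a "1-b"] uv assms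
      by (intro mult_left_mono add_mono) (auto simp: q_def algebra_simps)
    finally show ?thesis by (simp add: u_def v_def)
  qed
  have "(\<Sum>k<N. (1 + real k) powr (-a) * (1 / (1 + \<bar>x - real k\<bar>))) \<le> (8 * M) * (1 + \<bar>x\<bar>) powr (-b)" for x N
  proof -
    have "(\<Sum>k<N. (1 + real k) powr (-a) * (1 / (1 + \<bar>x - real k\<bar>))) * (1 + \<bar>x\<bar>) powr b
       \<le> (\<Sum>k<N. 4 * ((1 + real k) powr (-q) + (1 + \<bar>x - real k\<bar>) powr (-q)))"
      unfolding sum_distrib_right by (intro sum_mono term_le)
    \<comment> \<open>Writing 1 + k as 1 + |0 - k| makes the unshifted sum the instance x = 0 of the
      bound \<open>M\<close>.\<close>
    also have "\<dots> = 4 * ((\<Sum>k<N. (1 + \<bar>0 - real k\<bar>) powr (-q)) + (\<Sum>k<N. (1 + \<bar>x - real k\<bar>) powr (-q)))"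
      by (simp add: sum_distrib_left sum.distrib)
    also have "\<dots> \<le> 4 * (M + M)" by (intro mult_left_mono add_mono M) auto
    finally show ?thesis by (simp add: powr_minus field_simps)
  qed
  thus ?thesis using M(1) that[of "8 * M"] by simp
qed

section \<open>Iterated differences of the reciprocal\<close>

(* The n-th difference of 1/r: the sum over j <= n of (-1)^j binom(n, j) / (r + j). *)
definition inverse_diff :: "nat \<Rightarrow> real \<Rightarrow> real" where
  "inverse_diff n r = fact n / pochhammer r (Suc n)"

lemma inverse_diff_0 [simp]: "inverse_diff 0 r = 1 / r"
  by (simp add: inverse_diff_def)

lemma inverse_diff_Suc:
  assumes "r > 0"
  shows "inverse_diff (Suc n) r = inverse_diff n r * (real n + 1) / (r + real n + 1)"
  using assms by (simp add: inverse_diff_def pochhammer_Suc field_simps)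

lemma inverse_diff_plus1:
  assumes "r > 0"
  shows "inverse_diff n (r + 1) = inverse_diff n r * r / (r + real n + 1)"
proof -
  have "pochhammer r (Suc (Suc n)) = r * pochhammer (r + 1) (Suc n)"
    by (rule pochhammer_rec)
  moreover have "pochhammer r (Suc (Suc n)) = pochhammer r (Suc n) * (r + real (Suc n))"
    by (rule pochhammer_Suc)
  ultimately have eq: "r * pochhammer (r + 1) (Suc n) = pochhammer r (Suc n) * (r + real n + 1)"
    by (simp add: add_ac)
  have pos: "pochhammer r (Suc n) > 0" "pochhammer (r + 1) (Suc n) > 0"
    using assms by (auto intro: pochhammer_pos)
  show ?thesis unfolding inverse_diff_def
    using pos assms eq by (simp add: divide_simps mult_ac)
qed

lemma inverse_diff_pos: "r > 0 \<Longrightarrow> inverse_diff n r > 0"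
  unfolding inverse_diff_def by (auto intro!: divide_pos_pos pochhammer_pos)

lemma inverse_diff_Suc_le:
  assumes "r > 0"
  shows "inverse_diff (Suc n) r \<le> inverse_diff n r"
proof -
  have "inverse_diff (Suc n) r = inverse_diff n r * ((real n + 1) / (r + real n + 1))"
    using inverse_diff_Suc[OF assms] by simp
  also have "\<dots> \<le> inverse_diff n r * 1"
    using inverse_diff_pos[OF assms, of n] assms by (intro mult_left_mono) auto
  finally show ?thesis by simp
qed

lemma inverse_diff_le: "r > 0 \<Longrightarrow> inverse_diff n r \<le> 1 / r"
  by (induction n) (auto intro: order_trans[OF inverse_diff_Suc_le])

lemma inverse_diff_diff:
  assumes "r > 0"
  shows "inverse_diff (Suc n) r = inverse_diff n r - inverse_diff n (r + 1)"
proof -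
  have "r + real n + 1 \<noteq> 0" using assms by simp
  thus ?thesis
    unfolding inverse_diff_Suc[OF assms] inverse_diff_plus1[OF assms]
    by (simp add: divide_simps) (simp add: algebra_simps)
qed

section \<open>The partial fraction expansion of the Beta function\<close>

lemma alternating_gbinomial_Suc:
  fixes w :: "'a :: field_char_0"
  shows "(-1) ^ k * (w gchoose k) * (w - of_nat k) =
    - (of_nat (Suc k) * ((-1) ^ Suc k * (w gchoose Suc k)))"
proof -
  have "(w gchoose k) * (w - of_nat k) = of_nat (Suc k) * (w gchoose Suc k)"
    using gbinomial_mult_1[of w k] by (simp add: algebra_simps)
  hence "(-1) ^ k * ((w gchoose k) * (w - of_nat k)) = (-1) ^ k * (of_nat (Suc k) * (w gchoose Suc k))"
    by (rule arg_cong)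
  thus ?thesis by (simp add: mult_ac)
qed

text \<open>With c_N = (-1)^N binom(w, N), one has y c_N/(y+N) = c_N - N c_N/(y+N), while (w+y+1)
  c_N/(y+1+N) = c_N + (w-N) c_N/(y+1+N). Since (w-N) c_N = -(N+1) c_{N+1}, the corrections telescope
  and only the last boundary term remains.\<close>

lemma sum_alternating_gbinomial_shift:
  fixes w :: complex and y :: complex
  assumes "\<And>k::nat. y + of_nat k \<noteq> 0"
  shows "y * (\<Sum>k<N. (-1) ^ k * (w gchoose k) / (y + of_nat k)) =
    (w + y + 1) * (\<Sum>k<N. (-1) ^ k * (w gchoose k) / (y + 1 + of_nat k)) +
    of_nat N * ((-1) ^ N * (w gchoose N)) / (y + of_nat N)"
proof (induction N)
  case (Suc N)
  define c where "c = (-1) ^ N * (w gchoose N)"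
  define c' where "c' = (-1) ^ Suc N * (w gchoose Suc N)"
  have cc': "c * (w - of_nat N) = - (of_nat (Suc N) * c')"
    unfolding c_def c'_def by (rule alternating_gbinomial_Suc)
  have nz: "y + of_nat N \<noteq> 0" "y + 1 + of_nat N \<noteq> 0"
    using assms[of N] assms[of "Suc N"] by (auto simp: add_ac)
  have 1: "of_nat N * c / (y + of_nat N) + y * (c / (y + of_nat N)) = c"
  proof -
    have "(of_nat N * c + y * c) / (y + of_nat N) = c"
      using nz by (simp add: divide_eq_eq algebra_simps)
    thus ?thesis by (simp add: add_divide_distrib)
  qed
  have 2: "(w + y + 1) * (c / (y + 1 + of_nat N)) + of_nat (Suc N) * c' / (y + 1 + of_nat N) = c"
  proof -
    have "(w + y + 1) * c + of_nat (Suc N) * c' = c * (y + 1 + of_nat N)"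
      using cc' by algebra
    hence "((w + y + 1) * c + of_nat (Suc N) * c') / (y + 1 + of_nat N) = c"
      using nz by (simp only: divide_eq_eq) simp
    thus ?thesis by (simp only: add_divide_distrib times_divide_eq_right)
  qed
  have "y * (\<Sum>k<Suc N. (-1) ^ k * (w gchoose k) / (y + of_nat k)) =
     y * (\<Sum>k<N. (-1) ^ k * (w gchoose k) / (y + of_nat k)) + y * (c / (y + of_nat N))"
    by (simp only: sum.lessThan_Suc c_def distrib_left)
  also have "\<dots> = (w + y + 1) * (\<Sum>k<N. (-1) ^ k * (w gchoose k) / (y + 1 + of_nat k)) + c"
    unfolding Suc.IH c_def[symmetric] using 1 by (simp only: add.assoc)
  also have "\<dots> = (w + y + 1) * (\<Sum>k<Suc N. (-1) ^ k * (w gchoose k) / (y + 1 + of_nat k)) +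
      of_nat (Suc N) * c' / (y + 1 + of_nat N)"
    unfolding sum.lessThan_Suc c_def[symmetric]
    using 2 by (simp only: distrib_left add.assoc)
  also have "y + 1 + of_nat N = y + of_nat (Suc N)" by simp
  finally show ?case unfolding c'_def .
qed simp

lemma gbinomial_tendsto_0:
  fixes w :: complex
  assumes "Re w > -1"
  shows "(\<lambda>k. w gchoose k) \<longlonglongrightarrow> 0"
proof -
  obtain C where C: "\<And>k. norm (w gchoose k) \<le> C * (1 + real k) powr (-(Re w + 1))"
    using norm_gbinomial_le_powr[OF assms] by blast
  have "filterlim (\<lambda>k. 1 + real k) at_top sequentially"
    by (intro filterlim_tendsto_add_at_top[OF tendsto_const] filterlim_real_sequentially)
  hence "(\<lambda>k. (1 + real k) powr (-(Re w + 1))) \<longlonglongrightarrow> 0"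
    using assms by (intro tendsto_neg_powr) auto
  hence "(\<lambda>k. C * (1 + real k) powr (-(Re w + 1))) \<longlonglongrightarrow> 0"
    by (rule tendsto_mult_right_zero)
  moreover have "\<forall>\<^sub>F k in sequentially. norm (w gchoose k) \<le> C * (1 + real k) powr (-(Re w + 1))"
    using C by (intro always_eventually allI)
  ultimately show ?thesis by (rule Lim_null_comparison[rotated])
qed

text \<open>The boundary term of the finite identity vanishes because Re w > -1 forces the binomials
  to 0. Convergence is carried from y + 1 down to y, the direction in which the expansion is later
  extended to negative arguments.\<close>

lemma sums_alternating_gbinomial_shift:
  fixes w y S :: complex
  assumes w: "Re w > -1"
    and y: "\<And>k::nat. y + of_nat k \<noteq> 0"
    and S: "(\<lambda>k. (-1) ^ k * (w gchoose k) / (y + 1 + of_nat k)) sums S"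
  shows "(\<lambda>k. (-1) ^ k * (w gchoose k) / (y + of_nat k)) sums ((w + y + 1) * S / y)"
proof -
  have y0: "y \<noteq> 0" using y[of 0] by simp
  have "(\<lambda>N. of_nat N / (y + of_nat N)) \<longlonglongrightarrow> 1"
  proof -
    have "(\<lambda>N. 1 / (y * (1 / of_nat N) + 1)) \<longlonglongrightarrow> 1 / (y * 0 + 1)"
      by (intro tendsto_intros lim_1_over_n) auto
    moreover have "eventually (\<lambda>N. 1 / (y * (1 / of_nat N) + 1) = of_nat N / (y + of_nat N)) sequentially"
      using eventually_gt_at_top[of 0]
    proof eventually_elim
      case (elim N)
      hence "y * (1 / of_nat N) + 1 = (y + of_nat N) / of_nat N" by (simp add: add_divide_distrib)
      thus ?case by simp
    qed
    ultimately show ?thesis using tendsto_cong by fastforce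
  qed
  moreover have "(\<lambda>N. (-1) ^ N * (w gchoose N)) \<longlonglongrightarrow> 0"
  proof (rule tendsto_norm_zero_cancel)
    show "(\<lambda>N. norm ((-1) ^ N * (w gchoose N))) \<longlonglongrightarrow> 0"
      using tendsto_norm_zero[OF gbinomial_tendsto_0[OF w]] by (simp add: norm_mult norm_power)
  qed
  ultimately have E: "(\<lambda>N. of_nat N / (y + of_nat N) * ((-1) ^ N * (w gchoose N))) \<longlonglongrightarrow> 1 * 0"
    by (rule tendsto_mult)
  have "(\<lambda>N. ((w + y + 1) * (\<Sum>k<N. (-1) ^ k * (w gchoose k) / (y + 1 + of_nat k)) +
      of_nat N / (y + of_nat N) * ((-1) ^ N * (w gchoose N))) / y)
      \<longlonglongrightarrow> ((w + y + 1) * S + 1 * 0) / y"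
    using S y0 by (intro tendsto_intros E) (auto simp: sums_def)
  also have "(\<lambda>N. ((w + y + 1) * (\<Sum>k<N. (-1) ^ k * (w gchoose k) / (y + 1 + of_nat k)) +
      of_nat N / (y + of_nat N) * ((-1) ^ N * (w gchoose N))) / y) =
      (\<lambda>N. \<Sum>k<N. (-1) ^ k * (w gchoose k) / (y + of_nat k))"
  proof
    fix N
    show "((w + y + 1) * (\<Sum>k<N. (-1) ^ k * (w gchoose k) / (y + 1 + of_nat k)) +
      of_nat N / (y + of_nat N) * ((-1) ^ N * (w gchoose N))) / y =
      (\<Sum>k<N. (-1) ^ k * (w gchoose k) / (y + of_nat k))"
      unfolding times_divide_eq_left sum_alternating_gbinomial_shift[OF y, of w, symmetric]
      using y0 by simp
  qed
  finally show ?thesis by (simp add: sums_def)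
qed

text \<open>The decay exponents Re w + 1 and 1 add up to more than 1. This series is the majorant
  both for the convergence of every \<open>S n r\<close> and for the passage to the limit in
  n.\<close>

lemma summable_norm_gbinomial_divide:
  fixes w :: complex and r :: real
  assumes "Re w > -1" "r > 0"
  shows "summable (\<lambda>k. norm (w gchoose k) * (1 / (r + real k)))"
proof -
  obtain C where C: "C > 0" "\<And>k. norm (w gchoose k) \<le> C * (1 + real k) powr (-(Re w + 1))"
    using norm_gbinomial_le_powr[OF assms(1)] by blast
  have "summable (\<lambda>k. real (Suc k) powr (-(Re w + 2)))"
    using assms by (subst summable_Suc_iff) (simp add: summable_real_powr_iff)
  hence "summable (\<lambda>k. C * (1 + 1 / r) * real (Suc k) powr (-(Re w + 2)))"
    by (rule summable_mult)
  moreover have "norm (norm (w gchoose k) * (1 / (r + real k))) \<le>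
      C * (1 + 1 / r) * real (Suc k) powr (-(Re w + 2))" for k
  proof -
    \<comment> \<open>The factor 1 + 1/r compensates for r < 1: the product on the right is 1 + k +
      r + k/r.\<close>
    have "(1 + real k) * 1 \<le> (1 + 1 / r) * (r + real k)"
      using assms by (simp add: algebra_simps)
    hence "1 / (r + real k) \<le> (1 + 1 / r) / (1 + real k)"
      using assms by (subst frac_le_eq) (auto simp: divide_le_0_iff)
    also have "\<dots> = (1 + 1 / r) * (1 + real k) powr (-1)"
      by (simp add: powr_minus_divide)
    finally have "norm (w gchoose k) * (1 / (r + real k)) \<le>
       (C * (1 + real k) powr (-(Re w + 1))) * ((1 + 1 / r) * (1 + real k) powr (-1))"
      using C(1) assms by (intro mult_mono C(2)) auto
    also have "\<dots> = C * (1 + 1 / r) * ((1 + real k) powr (-(Re w + 1)) * (1 + real k) powr (-1))"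
      by (simp only: mult_ac)
    also have "(1 + real k) powr (-(Re w + 1)) * (1 + real k) powr (-1) = real (Suc k) powr (-(Re w + 2))"
      unfolding powr_add [symmetric] by (simp add: add.commute)
    finally show ?thesis using assms by simp
  qed
  ultimately show ?thesis by (rule summable_comparison_test'[where N = 0])
qed

text \<open>The factor r/(r + k) is the exact ratio at n = 0, and each further factor
  (n+1)/(r+k+n+1) is no larger than its counterpart at k = 0. The point is a bound on the ratio that
  is uniform in n.\<close>

lemma inverse_diff_ratio_le:
  assumes "r > 0"
  shows "inverse_diff n (r + real k) \<le> inverse_diff n r * (r / (r + real k))"
proof (induction n)
  case 0
  thus ?case using assms by simp
next
  case (Suc n)
  have pos: "inverse_diff n (r + real k) > 0" "inverse_diff n r > 0"
    using assms by (auto intro!: inverse_diff_pos)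
  have "inverse_diff (Suc n) (r + real k) = inverse_diff n (r + real k) * ((real n + 1) / (r + real k + real n + 1))"
    using inverse_diff_Suc[of "r + real k" n] assms by simp
  also have "\<dots> \<le> (inverse_diff n r * (r / (r + real k))) * ((real n + 1) / (r + real n + 1))"
    using assms pos by (intro mult_mono Suc.IH frac_le) auto
  also have "\<dots> = inverse_diff (Suc n) r * (r / (r + real k))"
    unfolding inverse_diff_Suc[OF assms] by (simp add: mult_ac)
  finally show ?case .
qed

lemma inverse_diff_mono:
  assumes "r > 0"
  shows "inverse_diff n (r + 1 + real k) \<le> inverse_diff n (r + 1)"
proof -
  have "inverse_diff n (r + 1 + real k) \<le> inverse_diff n (r + 1) * ((r + 1) / (r + 1 + real k))"
    using assms by (intro inverse_diff_ratio_le) auto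
  also have "\<dots> \<le> inverse_diff n (r + 1) * 1"
    using assms inverse_diff_pos[of "r + 1" n] by (intro mult_left_mono) auto
  finally show ?thesis by simp
qed

text \<open>For k >= 1 the numerator is at most \<open>inverse_diff n (r + 1)\<close>, which is
  smaller than \<open>inverse_diff n r\<close> by the factor r/(r + n + 1).\<close>

lemma tendsto_inverse_diff_ratio:
  assumes "r > 0"
  shows "(\<lambda>n. inverse_diff (Suc n) (r + real k) / inverse_diff n r) \<longlonglongrightarrow> (if k = 0 then 1 else 0)"
proof (cases k)
  case 0
  have "(\<lambda>n. (real n + 1) / (r + real n + 1)) \<longlonglongrightarrow> 1"
    by real_asymp
  moreover have "inverse_diff (Suc n) r / inverse_diff n r = (real n + 1) / (r + real n + 1)" for n
    using inverse_diff_pos[OF assms, of n] by (simp add: inverse_diff_Suc[OF assms])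
  ultimately show ?thesis using 0 by simp
next
  case (Suc j)
  have upper: "inverse_diff (Suc n) (r + real k) / inverse_diff n r \<le> r / (r + real n + 1)" for n
  proof -
    have p: "inverse_diff n r > 0" "inverse_diff n (r + real k) > 0"
      using assms by (auto intro!: inverse_diff_pos)
    have "inverse_diff (Suc n) (r + real k) \<le> inverse_diff n (r + real k)"
      using assms by (intro inverse_diff_Suc_le) auto
    also have "\<dots> = inverse_diff n (r + 1 + real j)" by (simp add: Suc add_ac)
    also have "\<dots> \<le> inverse_diff n (r + 1)" by (rule inverse_diff_mono[OF assms])
    also have "\<dots> = r / (r + real n + 1) * inverse_diff n r"
      by (simp add: inverse_diff_plus1[OF assms])
    finally show ?thesis using p by (simp add: pos_divide_le_eq)
  qed
  have lower: "0 \<le> inverse_diff (Suc n) (r + real k) / inverse_diff n r" for n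
    using assms by (intro divide_nonneg_nonneg less_imp_le inverse_diff_pos) auto
  have lim: "(\<lambda>n. r / (r + real n + 1)) \<longlonglongrightarrow> 0" by real_asymp
  have "(\<lambda>n. inverse_diff (Suc n) (r + real k) / inverse_diff n r) \<longlonglongrightarrow> 0"
    by (rule real_tendsto_sandwich[OF always_eventually[OF allI[OF lower]]
          always_eventually[OF allI[OF upper]] tendsto_const lim])
  thus ?thesis using Suc by simp
qed

lemma plus1_notin_nonpos_Ints:
  assumes "Re w > -1"
  shows "w + 1 \<notin> \<int>\<^sub>\<le>\<^sub>0"
proof
  assume "w + 1 \<in> \<int>\<^sub>\<le>\<^sub>0"
  then obtain n where "w + 1 = - of_nat n" by (auto elim: nonpos_Ints_cases')
  hence "Re (w + 1) = - real n" by simp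
  thus False using assms by simp
qed

(* S 0 r is the partial fraction series.  A shift recurrence for S n turns the difference equation
   S (n+1) r = S n r - S n (r+1) into a product formula in n, and S (n+1) r is asymptotic to
   inverse_diff n r because only the term k = 0 survives; Gauss's product for Gamma then
   evaluates S 0 r. *)
context
  fixes w :: complex and c :: "nat \<Rightarrow> complex" and S :: "nat \<Rightarrow> real \<Rightarrow> complex"
  assumes w: "Re w > -1"
  defines "c \<equiv> \<lambda>k. (-1) ^ k * (w gchoose k)"
  defines "S \<equiv> \<lambda>n r. \<Sum>k. c k * of_real (inverse_diff n (r + real k))"
begin

private lemma norm_c: "norm (c k) = norm (w gchoose k)"
  by (simp add: c_def norm_mult norm_power)

private lemma summable_S:
  assumes r: "r > 0"
  shows "summable (\<lambda>k. c k * of_real (inverse_diff n (r + real k)))"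
proof (rule summable_comparison_test')
  show "summable (\<lambda>k. norm (w gchoose k) * (1 / (r + real k)))"
    by (rule summable_norm_gbinomial_divide[OF w r])
  fix k
  have "\<bar>inverse_diff n (r + real k)\<bar> \<le> 1 / (r + real k)"
    using inverse_diff_le[of "r + real k" n] inverse_diff_pos[of "r + real k" n] r by simp
  thus "norm (c k * of_real (inverse_diff n (r + real k))) \<le> norm (w gchoose k) * (1 / (r + real k))"
    by (simp only: norm_mult norm_c norm_of_real mult_left_mono norm_ge_zero)
qed

private lemma S_Suc_diff:
  assumes r: "r > 0"
  shows "S (Suc n) r = S n r - S n (r + 1)"
proof -
  have "S n r - S n (r + 1) = (\<Sum>k. c k * of_real (inverse_diff n (r + real k)) -
          c k * of_real (inverse_diff n (r + 1 + real k)))"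
    unfolding S_def using r by (intro suminf_diff summable_S) auto
  also have "(\<lambda>k. c k * of_real (inverse_diff n (r + real k)) -
          c k * of_real (inverse_diff n (r + 1 + real k))) =
     (\<lambda>k. c k * of_real (inverse_diff (Suc n) (r + real k)))"
  proof
    fix k
    have "inverse_diff (Suc n) (r + real k) = inverse_diff n (r + real k) - inverse_diff n (r + 1 + real k)"
      using inverse_diff_diff[of "r + real k" n] r by (simp add: add_ac)
    thus "c k * of_real (inverse_diff n (r + real k)) - c k * of_real (inverse_diff n (r + 1 + real k)) =
      c k * of_real (inverse_diff (Suc n) (r + real k))"
      by (simp add: right_diff_distrib)
  qed
  finally show ?thesis by (simp add: S_def)
qed

private lemma sums_S0:
  assumes r: "r > 0"
  shows "(\<lambda>k. c k / (of_real r + of_nat k)) sums S 0 r"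
  using summable_sums[OF summable_S[OF r, of 0]] by (simp add: S_def divide_inverse)

private lemma S_shift:
  assumes r: "r > 0"
  shows "(w + of_real r + of_nat n + 1) * S n (r + 1) = of_real r * S n r"
  using r
proof (induction n arbitrary: r)
  case (0 r)
  have nz: "of_real r + of_nat k \<noteq> (0 :: complex)" for k
  proof -
    have "r + real k \<noteq> 0" using 0 by linarith
    hence "complex_of_real (r + real k) \<noteq> 0" unfolding of_real_eq_0_iff .
    thus ?thesis by simp
  qed
  have "(\<lambda>k. c k / (of_real r + 1 + of_nat k)) sums S 0 (r + 1)"
    using sums_S0[of "r + 1"] 0 by simp
  from sums_alternating_gbinomial_shift[OF w nz this[unfolded c_def]]
  have "(\<lambda>k. c k / (of_real r + of_nat k)) sums ((w + of_real r + 1) * S 0 (r + 1) / of_real r)"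
    unfolding c_def .
  hence "S 0 r = (w + of_real r + 1) * S 0 (r + 1) / of_real r"
    using sums_S0[OF 0] sums_unique2 by blast
  thus ?case using 0 by simp
next
  case (Suc n r)
  have r: "r > 0" "r + 1 > 0" using Suc by auto
  have 1: "(w + of_real r + of_nat n + 1) * S n (r + 1) = of_real r * S n r"
    by (rule Suc.IH[OF r(1)])
  have 2: "(w + of_real r + of_nat n + 2) * S n (r + 1 + 1) = (of_real r + 1) * S n (r + 1)"
    using Suc.IH[OF r(2)] by (simp add: algebra_simps)
  \<comment> \<open>By the relations at r and at r + 1, both sides equal (w + n + 1)
    \<open>S n (r + 1)\<close>.\<close>
  have "(w + of_real r + of_nat n + 2) * (S n (r + 1) - S n (r + 1 + 1)) = of_real r * (S n r - S n (r + 1))"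
    using 1 2 by algebra
  thus ?case unfolding S_Suc_diff[OF r(1)] S_Suc_diff[OF r(2)] by (simp add: algebra_simps)
qed

private lemma S_Suc:
  assumes r: "r > 0"
  shows "S (Suc n) r * (w + of_real r + of_nat n + 1) = S n r * (w + of_nat n + 1)"
  unfolding S_Suc_diff[OF r] using S_shift[OF r, of n] by algebra

private lemma S_pochhammer:
  assumes r: "r > 0"
  shows "S 0 r * pochhammer (w + 1) n = S n r * pochhammer (w + 1 + of_real r) n"
proof (induction n)
  case (Suc n)
  have "S 0 r * pochhammer (w + 1) (Suc n) = S n r * pochhammer (w + 1 + of_real r) n * (w + 1 + of_nat n)"
    using Suc by (simp add: pochhammer_Suc flip: mult.assoc)
  also have "\<dots> = pochhammer (w + 1 + of_real r) n * (S n r * (w + of_nat n + 1))"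
    by (simp only: mult_ac add_ac)
  also have "\<dots> = S (Suc n) r * pochhammer (w + 1 + of_real r) (Suc n)"
    unfolding S_Suc[OF r, symmetric] by (simp only: pochhammer_Suc mult_ac add_ac)
  finally show ?case .
qed simp

text \<open>Tannery's theorem moves the limit inside the series. The offset between n + 1 and n
  matches \<open>rGamma_series\<close>, whose n-th term contains a Pochhammer symbol of length n +
  1.\<close>

private lemma S_asymptotic:
  assumes r: "r > 0"
  shows "(\<lambda>n. S (Suc n) r / of_real (inverse_diff n r)) \<longlonglongrightarrow> 1"
proof -
  define a where "a = (\<lambda>k n. c k * of_real (inverse_diff (Suc n) (r + real k) / inverse_diff n r))"
  define b where "b = (\<lambda>k::nat. if k = 0 then 1 else (0::complex))"
  define M where "M = (\<lambda>k. r * (norm (w gchoose k) * (1 / (r + real k))))"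
  have lim: "(\<lambda>n. a k n) \<longlonglongrightarrow> b k" for k
  proof -
    have "(\<lambda>n. a k n) \<longlonglongrightarrow> c k * of_real (if k = 0 then 1 else 0)"
      unfolding a_def by (intro tendsto_mult tendsto_const tendsto_of_real tendsto_inverse_diff_ratio r)
    thus ?thesis by (simp add: b_def c_def split: if_splits)
  qed
  have bound: "norm (a k n) \<le> M k" for k n
  proof -
    have p: "inverse_diff n r > 0" "inverse_diff (Suc n) r > 0" "inverse_diff (Suc n) (r + real k) > 0"
      using r by (auto intro!: inverse_diff_pos)
    have "inverse_diff (Suc n) r \<le> inverse_diff n r"
      by (rule inverse_diff_Suc_le[OF r])
    hence "inverse_diff (Suc n) r * (r / (r + real k)) \<le> inverse_diff n r * (r / (r + real k))"
      using r by (intro mult_right_mono) auto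
    with inverse_diff_ratio_le[OF r, of "Suc n" k]
    have "inverse_diff (Suc n) (r + real k) \<le> inverse_diff n r * (r / (r + real k))"
      by (rule order_trans)
    hence "inverse_diff (Suc n) (r + real k) / inverse_diff n r \<le> r / (r + real k)"
      using p by (simp add: pos_divide_le_eq mult.commute)
    hence "norm (c k) * \<bar>inverse_diff (Suc n) (r + real k) / inverse_diff n r\<bar> \<le> norm (c k) * (r / (r + real k))"
      using p by (intro mult_left_mono) auto
    thus ?thesis unfolding a_def M_def norm_mult norm_of_real norm_c by (simp add: mult_ac)
  qed
  have "summable M" unfolding M_def by (intro summable_mult summable_norm_gbinomial_divide w r)
  moreover have "eventually (\<lambda>(k,n). norm (a k n) \<le> M k) (at_top \<times>\<^sub>F sequentially)"
    by (intro always_eventually) (use bound in auto)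
  ultimately have "(\<lambda>n. suminf (\<lambda>k. a k n)) \<longlonglongrightarrow> suminf b"
    using tannerys_theorem[of a b sequentially M] lim sequentially_bot by blast
  moreover have "suminf b = 1"
    using sums_single[of 0 "\<lambda>_. 1::complex"] unfolding b_def by (simp add: sums_iff)
  moreover have "suminf (\<lambda>k. a k n) = S (Suc n) r / of_real (inverse_diff n r)" for n
    unfolding S_def using suminf_divide[OF summable_S[OF r, of "Suc n"], of "of_real (inverse_diff n r)"]
    by (simp only: a_def of_real_divide times_divide_eq_right)
  ultimately show ?thesis by (simp only:)
qed

private lemma S0_eq:
  assumes r: "r > 0"
  shows "S 0 r = Gamma (w + 1) * Gamma (of_real r) * rGamma (w + 1 + of_real r)"
proof -
  \<comment> \<open>The powers n^(w+1) n^r and n^(w+1+r) agree, so the Gauss products on the two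
    sides differ only by the quotient that tends to 1.\<close>
  have eq: "S 0 r * rGamma_series (w + 1) n * rGamma_series (of_real r) n =
     rGamma_series (w + 1 + of_real r) n * (S (Suc n) r / of_real (inverse_diff n r))" for n
  proof -
    have arith: "(A * Q) * P / (F * (F * E)) = Q / (F * E) * (A / (F / P))" for A Q P F E :: complex
      by (simp add: mult_ac)
    define L where "L = complex_of_real (ln (of_nat n))"
    define P where "P = pochhammer (complex_of_real r) (Suc n)"
    have exp: "exp ((w + 1 + of_real r) * L) = exp ((w + 1) * L) * exp (of_real r * L)"
      by (simp add: algebra_simps flip: exp_add)
    have id: "of_real (inverse_diff n r) = (fact n / P :: complex)"
      unfolding inverse_diff_def P_def by (simp add: pochhammer_of_real)
    have "S 0 r * rGamma_series (w + 1) n * rGamma_series (of_real r) n =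
      (S 0 r * pochhammer (w + 1) (Suc n)) * P / (fact n * exp ((w + 1) * L) * (fact n * exp (of_real r * L)))"
      by (simp add: rGamma_series_def L_def P_def)
    also have "\<dots> = (S (Suc n) r * pochhammer (w + 1 + of_real r) (Suc n)) * P /
        (fact n * (fact n * exp ((w + 1 + of_real r) * L)))"
      unfolding exp S_pochhammer[OF r] by (simp add: mult_ac)
    also have "\<dots> = rGamma_series (w + 1 + of_real r) n * (S (Suc n) r / of_real (inverse_diff n r))"
      using arith[of "S (Suc n) r" "pochhammer (w + 1 + of_real r) (Suc n)" P "fact n"
          "exp ((w + 1 + of_real r) * L)"]
      unfolding id rGamma_series_def L_def Suc_eq_plus1 .
    finally show ?thesis .
  qed
  have "(\<lambda>n. S 0 r * rGamma_series (w + 1) n * rGamma_series (of_real r) n) \<longlonglongrightarrow>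
      S 0 r * rGamma (w + 1) * rGamma (of_real r)"
    by (intro tendsto_intros)
  moreover have "(\<lambda>n. S 0 r * rGamma_series (w + 1) n * rGamma_series (of_real r) n) \<longlonglongrightarrow>
      rGamma (w + 1 + of_real r) * 1"
    unfolding eq by (intro tendsto_mult S_asymptotic r rGamma_series_LIMSEQ)
  ultimately have "S 0 r * rGamma (w + 1) * rGamma (of_real r) = rGamma (w + 1 + of_real r)"
    using LIMSEQ_unique by fastforce
  moreover have "w + 1 \<notin> \<int>\<^sub>\<le>\<^sub>0" by (rule plus1_notin_nonpos_Ints[OF w])
  moreover have "complex_of_real r \<notin> \<int>\<^sub>\<le>\<^sub>0"
  proof
    assume "complex_of_real r \<in> \<int>\<^sub>\<le>\<^sub>0"
    then obtain n where "complex_of_real r = - of_nat n" by (auto elim: nonpos_Ints_cases')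
    hence "Re (of_real r) = - real n" by simp
    thus False using r by simp
  qed
  ultimately show ?thesis
    by (simp add: Gamma_def rGamma_eq_zero_iff field_simps)
qed

text \<open>The case r > 0 is extended to all real r outside the poles by induction on a number m of
  unit steps after which r becomes positive. The Gamma quotient obeys the same backward shift as the
  series; \<open>rGamma\<close> keeps it meaningful where w + 1 + r meets a pole of Gamma.\<close>

lemma sums_Beta_partial_fractions:
  assumes r: "\<And>k::nat. r + real k \<noteq> 0"
  shows "(\<lambda>k. (-1) ^ k * (w gchoose k) / (of_real r + of_nat k)) sums
    (Gamma (w + 1) * Gamma (of_real r) * rGamma (w + 1 + of_real r))"
proof -
  have "(\<lambda>k. c k / (of_real r + of_nat k)) sums
    (Gamma (w + 1) * Gamma (of_real r) * rGamma (w + 1 + of_real r))"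
    if "\<And>k::nat. r + real k \<noteq> 0" "r + real m > 0" for m r
    using that
  proof (induction m arbitrary: r)
    case (0 r)
    thus ?case using sums_S0[of r] S0_eq[of r] by simp
  next
    case (Suc m r)
    have nz: "of_real r + of_nat k \<noteq> (0 :: complex)" for k
    proof -
      have "complex_of_real (r + real k) \<noteq> 0" unfolding of_real_eq_0_iff using Suc.prems(1) .
      thus ?thesis by simp
    qed
    have r0: "complex_of_real r \<noteq> 0" using nz[of 0] by simp
    have rn: "complex_of_real r \<notin> \<int>\<^sub>\<le>\<^sub>0"
    proof
      assume "complex_of_real r \<in> \<int>\<^sub>\<le>\<^sub>0"
      then obtain n where "complex_of_real r = - of_nat n" by (auto elim: nonpos_Ints_cases')
      thus False using nz[of n] by simp
    qed
    have "(\<lambda>k. c k / (of_real (r + 1) + of_nat k)) sums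
      (Gamma (w + 1) * Gamma (of_real (r + 1)) * rGamma (w + 1 + of_real (r + 1)))" (is "_ sums ?S'")
    proof (rule Suc.IH)
      fix k show "r + 1 + real k \<noteq> 0" using Suc.prems(1)[of "Suc k"] by (simp add: add_ac)
    qed (use Suc.prems in simp)
    hence "(\<lambda>k. c k / (of_real r + 1 + of_nat k)) sums ?S'" by simp
    from sums_alternating_gbinomial_shift[OF w nz this[unfolded c_def]]
    have "(\<lambda>k. c k / (of_real r + of_nat k)) sums ((w + of_real r + 1) * ?S' / of_real r)"
      unfolding c_def .
    also have "(w + of_real r + 1) * ?S' / of_real r =
      Gamma (w + 1) * (Gamma (of_real r + 1) / of_real r) * ((w + 1 + of_real r) * rGamma ((w + 1 + of_real r) + 1))"
      by (simp add: mult_ac add_ac)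
    also have "\<dots> = Gamma (w + 1) * Gamma (of_real r) * rGamma (w + 1 + of_real r)"
      unfolding rGamma_plus1 Gamma_plus1[OF rn] using r0 by simp
    finally show ?case .
  qed
  moreover obtain m :: nat where "- r < real m" using reals_Archimedean2 by blast
  hence "r + real m > 0" by simp
  ultimately show ?thesis using r unfolding c_def by blast
qed

end

section \<open>The sinc expansion of the generalized binomial coefficient\<close>

lemma gen_binomial_of_nat:
  assumes "Re w > -1"
  shows "gen_binomial w (of_nat k) = w gchoose k"
proof -
  have "rGamma (of_nat k + 1 :: complex) = 1 / fact k"
    using Gamma_fact[of k, where 'a = complex]
    by (simp add: rGamma_inverse_Gamma inverse_eq_divide add.commute)
  thus ?thesis
    unfolding gbinomial_Gamma[OF plus1_notin_nonpos_Ints[OF assms]] gen_binomial_def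
    by (simp add: rGamma_inverse_Gamma field_simps)
qed

definition normalized_sinc :: "real \<Rightarrow> real" where
  "normalized_sinc u = (if u = 0 then 1 else sin (pi * u) / (pi * u))"

text \<open>Since sin(pi (x - k)) = (-1)^k sin(pi x), the sinc factors supply the alternating signs
  and the denominators. Reflection rewrites -sin(pi x)/pi as rGamma(-x) rGamma(x + 1), whose first
  factor cancels Gamma(-x); this is legitimate because a non-integer x keeps -x off the
  poles.\<close>

lemma sums_gen_binomial_normalized_sinc:
  fixes x :: real
  assumes w: "Re w > -1" and x: "x \<notin> \<int>"
  shows "(\<lambda>k. (w gchoose k) * of_real (normalized_sinc (x - real k))) sums gen_binomial w (of_real x)"
proof -
  have x': "x - real k \<noteq> 0" for k using x by auto
  have "(\<lambda>k. (-1) ^ k * (w gchoose k) / (of_real (-x) + of_nat k)) sums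
    (Gamma (w + 1) * Gamma (of_real (-x)) * rGamma (w + 1 + of_real (-x)))"
    using x' by (intro sums_Beta_partial_fractions w) (auto simp: algebra_simps)
  hence "(\<lambda>k. - (sin (of_real pi * of_real x) / of_real pi) *
       ((-1) ^ k * (w gchoose k) / (of_real (-x) + of_nat k))) sums
    (- (sin (of_real pi * of_real x) / of_real pi) *
     (Gamma (w + 1) * Gamma (of_real (-x)) * rGamma (w + 1 + of_real (-x))))"
    by (rule sums_mult)
  also have "(\<lambda>k. - (sin (of_real pi * of_real x) / of_real pi) *
       ((-1) ^ k * (w gchoose k) / (of_real (-x) + of_nat k))) =
     (\<lambda>k. (w gchoose k) * of_real (normalized_sinc (x - real k)))"
  proof
    fix k
    have "normalized_sinc (x - real k) = (-1) ^ k * sin (pi * x) / (pi * (x - real k))"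
      using x'[of k] by (simp add: normalized_sinc_def right_diff_distrib sin_diff mult.commute)
    hence "complex_of_real (normalized_sinc (x - real k)) =
       (-1) ^ k * sin (of_real pi * of_real x) / (of_real pi * (of_real x - of_nat k))"
      by (simp flip: sin_of_real)
    moreover have "complex_of_real x - of_nat k = - (of_real (-x) + of_nat k)" by simp
    moreover have "- (a / p) * (b * g / d) = g * (b * a / (p * (- d)))" for a b d g p :: complex
      by (cases "p = 0"; cases "d = 0") (simp_all add: field_simps)
    ultimately show "- (sin (of_real pi * of_real x) / of_real pi) *
       ((-1) ^ k * (w gchoose k) / (of_real (-x) + of_nat k)) =
       (w gchoose k) * of_real (normalized_sinc (x - real k))"
      by (simp only:)
  qed
  also have "- (sin (of_real pi * of_real x) / of_real pi) *
     (Gamma (w + 1) * Gamma (of_real (-x)) * rGamma (w + 1 + of_real (-x))) = gen_binomial w (of_real x)"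
  proof -
    have "rGamma (of_real (-x)) * rGamma (1 - of_real (-x)) =
        sin (of_real pi * of_real (-x)) / complex_of_real pi"
      by (rule rGamma_reflection_complex)
    hence eq: "- (sin (of_real pi * of_real x) / of_real pi) =
        rGamma (of_real (-x)) * rGamma (of_real x + 1 :: complex)"
      by (simp add: add_ac)
    have "complex_of_real (-x) \<notin> \<int>\<^sub>\<le>\<^sub>0"
    proof
      assume "complex_of_real (-x) \<in> \<int>\<^sub>\<le>\<^sub>0"
      hence "- x \<in> \<int>" unfolding of_real_in_Ints_iff [symmetric, where 'a = complex] by (rule nonpos_Ints_Int)
      thus False using x by (simp only: minus_in_Ints_iff)
    qed
    hence "rGamma (of_real (-x)) * Gamma (of_real (-x)) = (1::complex)"
      by (simp add: Gamma_def rGamma_eq_zero_iff)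
    moreover have "w + 1 + of_real (-x) = w - of_real x + 1" by simp
    moreover have "(a * b) * (g * d * e) = (a * d) * (g * b * e)" for a b d e g :: complex
      by (simp only: mult_ac)
    ultimately show ?thesis unfolding eq gen_binomial_def by (simp only: mult_1)
  qed
  finally show ?thesis .
qed

section \<open>The Fourier integral of L1 functions and the multiplication formula\<close>

lemma borel_measurable_fourier_integral [measurable]:
  assumes [measurable]: "f \<in> borel_measurable borel"
  shows "fourier_integral f \<in> borel_measurable borel"
proof -
  have "fourier_integral f = (\<lambda>\<xi>. LINT x|lborel. f x * exp (- 2 * of_real pi * \<i> * of_real x * of_real \<xi>))"
    unfolding fourier_integral_def by (intro ext integral_completion) measurable
  also have "\<dots> \<in> borel_measurable borel" by measurable
  finally show ?thesis .
qed

text \<open>For Borel functions the completed measure can be replaced by \<open>lborel\<close>, for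
  which joint measurability and Fubini's theorem are at hand.\<close>

lemma fourier_integral_lborel:
  assumes [measurable]: "f \<in> borel_measurable borel"
  shows "fourier_integral f \<xi> = (LINT x|lborel. f x * exp (- 2 * of_real pi * \<i> * of_real x * of_real \<xi>))"
  unfolding fourier_integral_def by (intro integral_completion) measurable

lemma norm_exp_imaginary_kernel [simp]:
  "norm (exp (- 2 * complex_of_real pi * \<i> * of_real x * of_real \<xi>)) = 1"
  by (simp add: norm_exp_eq_Re)

lemma integrable_times_bounded:
  fixes f h :: "'a \<Rightarrow> complex"
  assumes f: "integrable M f" and h: "h \<in> borel_measurable M" and C: "\<And>x. norm (h x) \<le> C"
  shows "integrable M (\<lambda>x. f x * h x)"
proof (rule Bochner_Integration.integrable_bound)
  show "integrable M (\<lambda>x. C *\<^sub>R f x)" using f by simp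
  show "(\<lambda>x. f x * h x) \<in> borel_measurable M" using f h by measurable
  have C0: "C \<ge> 0" using C norm_ge_zero order_trans by blast
  show "AE x in M. norm (f x * h x) \<le> norm (C *\<^sub>R f x)"
  proof (intro AE_I2)
    fix x
    have "norm (f x) * norm (h x) \<le> norm (f x) * C" by (intro mult_left_mono C) auto
    thus "norm (f x * h x) \<le> norm (C *\<^sub>R f x)" using C0 by (simp add: norm_mult mult.commute)
  qed
qed

lemma norm_fourier_integral_le:
  assumes [measurable]: "f \<in> borel_measurable borel"
  shows "norm (fourier_integral f \<xi>) \<le> (LINT x|lborel. norm (f x))"
  unfolding fourier_integral_lborel[OF assms]
  by (rule order_trans[OF integral_norm_bound]) (simp add: norm_mult)

text \<open>Fubini's theorem, applicable because the kernel has modulus 1 and the double integrand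
  has modulus |f(x)| |h(xi)|. Gaussian choices of h lead to the L2 bound; a band character leads to
  the sinc integrals.\<close>

lemma fourier_multiplication_formula:
  fixes f h :: "real \<Rightarrow> complex"
  assumes f: "integrable lborel f" and h: "integrable lborel h"
  shows "(LINT \<xi>|lborel. fourier_integral f \<xi> * h \<xi>) = (LINT x|lborel. f x * fourier_integral h x)"
proof -
  define E where "E = (\<lambda>x \<xi>. exp (- 2 * complex_of_real pi * \<i> * of_real x * of_real \<xi>))"
  have [measurable]: "f \<in> borel_measurable borel" "h \<in> borel_measurable borel"
    using f h by auto
  have "integrable (lborel \<Otimes>\<^sub>M lborel) (\<lambda>(x, \<xi>). f x * h \<xi> * E x \<xi>)"
  proof (rule lborel_pair.Fubini_integrable)
    show "(\<lambda>(x, \<xi>). f x * h \<xi> * E x \<xi>) \<in> borel_measurable (lborel \<Otimes>\<^sub>M lborel)"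
      unfolding E_def by measurable
    have "integrable lborel (\<lambda>x. norm (f x) * (LINT \<xi>|lborel. norm (h \<xi>)))"
      using f by (intro integrable_mult_left integrable_norm)
    thus "integrable lborel (\<lambda>x. LINT \<xi>|lborel. norm (case (x, \<xi>) of (x, \<xi>) \<Rightarrow> f x * h \<xi> * E x \<xi>))"
      by (simp add: norm_mult E_def)
    have "integrable lborel (\<lambda>\<xi>. f x * (h \<xi> * E x \<xi>))" for x
      unfolding E_def by (intro integrable_mult_right integrable_times_bounded[where C = 1] h) auto
    thus "AE x in lborel. integrable lborel (\<lambda>\<xi>. case (x, \<xi>) of (x, \<xi>) \<Rightarrow> f x * h \<xi> * E x \<xi>)"
      by (simp add: mult.assoc)
  qed
  from lborel_pair.Fubini_integral[OF this]
  have eq: "(LINT \<xi>|lborel. LINT x|lborel. f x * h \<xi> * E x \<xi>) = (LINT x|lborel. LINT \<xi>|lborel. f x * h \<xi> * E x \<xi>)" .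
  have "(LINT \<xi>|lborel. fourier_integral f \<xi> * h \<xi>) = (LINT \<xi>|lborel. LINT x|lborel. f x * h \<xi> * E x \<xi>)"
  proof (intro Bochner_Integration.integral_cong refl)
    fix \<xi>
    have "fourier_integral f \<xi> * h \<xi> = (LINT x|lborel. (f x * E x \<xi>) * h \<xi>)"
      unfolding integral_mult_left_zero by (simp add: fourier_integral_lborel E_def)
    thus "fourier_integral f \<xi> * h \<xi> = (LINT x|lborel. f x * h \<xi> * E x \<xi>)" by (simp add: mult_ac)
  qed
  also have "\<dots> = (LINT x|lborel. LINT \<xi>|lborel. f x * h \<xi> * E x \<xi>)" by (rule eq)
  also have "(LINT x|lborel. LINT \<xi>|lborel. f x * h \<xi> * E x \<xi>) = (LINT x|lborel. f x * fourier_integral h x)"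
  proof (intro Bochner_Integration.integral_cong refl)
    fix x
    have "f x * fourier_integral h x = (LINT \<xi>|lborel. f x * (h \<xi> * E x \<xi>))"
      unfolding integral_mult_right_zero by (simp add: fourier_integral_lborel E_def mult_ac)
    thus "(LINT \<xi>|lborel. f x * h \<xi> * E x \<xi>) = f x * fourier_integral h x" by (simp only: mult.assoc)
  qed
  finally show ?thesis .
qed

section \<open>Gaussian regularization and Plancherel's inequality\<close>

text \<open>The substitution t = 2 pi s xi reduces this to the characteristic function of the
  standard normal distribution at -(y - x)/s. The Gaussian is scaled so that its transform is a
  probability density of standard deviation s; the modulation moves the centre to x.\<close>

lemma fourier_integral_gaussian:
  assumes s: "s > 0"
  shows "fourier_integral (\<lambda>\<xi>. of_real (exp (- (2 * pi * s * \<xi>)\<^sup>2 / 2)) * exp (2 * of_real pi * \<i> * of_real x * of_real \<xi>)) y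
     = of_real (normal_density 0 s (y - x))"
proof -
  define u where "u = y - x"
  define c where "c = 2 * pi * s"
  have c: "c > 0" using s by (simp add: c_def)
  have "char std_normal_distribution (- (u / s)) = 
     (LINT t|lborel. std_normal_density t *\<^sub>R iexp (- (u / s) * t))"
    unfolding char_def by (subst integral_density) auto
  also have "\<dots> = (LINT t|lborel. of_real (1 / sqrt (2 * pi)) * (of_real (exp (- t\<^sup>2 / 2)) * iexp (- (u / s) * t)))"
    by (simp add: std_normal_density_def scaleR_conv_of_real mult_ac)
  also have "\<dots> = of_real (1 / sqrt (2 * pi)) * (LINT t|lborel. (of_real (exp (- t\<^sup>2 / 2)) * iexp (- (u / s) * t)))"
    by (rule integral_mult_right_zero)
  also have "(LINT t|lborel. (of_real (exp (- t\<^sup>2 / 2)) * iexp (- (u / s) * t))) =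
    c *\<^sub>R (LINT \<xi>|lborel. (of_real (exp (- (c * \<xi>)\<^sup>2 / 2)) * iexp (- (u / s) * (c * \<xi>))))"
    using lborel_integral_real_affine[of c "\<lambda>t. of_real (exp (- t\<^sup>2 / 2)) * iexp (- (u / s) * t)" 0] c by simp
  finally have eq: "(LINT \<xi>|lborel. (of_real (exp (- (c * \<xi>)\<^sup>2 / 2)) * iexp (- (u / s) * (c * \<xi>)))) =
    of_real (sqrt (2 * pi) / c * exp (- (u / s)\<^sup>2 / 2))"
    using c unfolding char_std_normal_distribution by (simp add: field_simps scaleR_conv_of_real)
  have "fourier_integral (\<lambda>\<xi>. of_real (exp (- (2 * pi * s * \<xi>)\<^sup>2 / 2)) * exp (2 * of_real pi * \<i> * of_real x * of_real \<xi>)) y =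
    (LINT \<xi>|lborel. (of_real (exp (- (c * \<xi>)\<^sup>2 / 2)) * iexp (- (u / s) * (c * \<xi>))))"
    unfolding c_def
  proof (subst fourier_integral_lborel, measurable, intro Bochner_Integration.integral_cong refl)
    fix \<xi>
    have "exp (2 * of_real pi * \<i> * of_real x * of_real \<xi>) * exp (- 2 * of_real pi * \<i> * of_real \<xi> * of_real y) =
      iexp (- (u / s) * (2 * pi * s * \<xi>))"
    proof -
      have "2 * complex_of_real pi * \<i> * of_real x * of_real \<xi> + - 2 * of_real pi * \<i> * of_real \<xi> * of_real y =
        \<i> * of_real (- (u / s) * (2 * pi * s * \<xi>))"
        using s by (simp add: u_def) (simp add: algebra_simps)
      thus ?thesis by (simp only: flip: exp_add)
    qed
    thus "of_real (exp (- (2 * pi * s * \<xi>)\<^sup>2 / 2)) * exp (2 * of_real pi * \<i> * of_real x * of_real \<xi>) *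
        exp (- 2 * of_real pi * \<i> * of_real \<xi> * of_real y) =
       of_real (exp (- (2 * pi * s * \<xi>)\<^sup>2 / 2)) * iexp (- (u / s) * (2 * pi * s * \<xi>))"
      by (simp only: mult.assoc)
  qed
  also have "\<dots> = of_real (sqrt (2 * pi) / c * exp (- (u / s)\<^sup>2 / 2))" by (rule eq)
  also have "sqrt (2 * pi) / c * exp (- (u / s)\<^sup>2 / 2) = normal_density 0 s (y - x)"
  proof -
    have "sqrt (2 * pi) / c = 1 / sqrt (2 * pi * s\<^sup>2)"
      using s real_sqrt_mult_self[of "2 * pi"] by (simp add: c_def real_sqrt_mult field_simps)
    thus ?thesis by (simp add: normal_density_def u_def power_divide)
  qed
  finally show ?thesis .
qed

lemma integrable_gaussian_exp:
  assumes s: "s > 0"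
  shows "integrable lborel (\<lambda>\<xi>. exp (- (2 * pi * s * \<xi>)\<^sup>2 / 2))"
proof -
  define r where "r = 1 / (2 * pi * s)"
  have r: "r > 0" using s by (simp add: r_def)
  have "integrable lborel (\<lambda>\<xi>. sqrt (2 * pi * r\<^sup>2) * normal_density 0 r \<xi>)" using r by simp
  also have "(\<lambda>\<xi>. sqrt (2 * pi * r\<^sup>2) * normal_density 0 r \<xi>) = (\<lambda>\<xi>. exp (- (2 * pi * s * \<xi>)\<^sup>2 / 2))"
    using s by (auto simp: fun_eq_iff normal_density_def r_def power_divide power_mult_distrib)
  finally show ?thesis .
qed

text \<open>Fatou's lemma as lower semicontinuity. It removes the Gaussian weight below and later
  passes L2 bounds to an almost everywhere limit.\<close>

lemma nn_integral_le_of_tendsto: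
  fixes u :: "nat \<Rightarrow> 'a \<Rightarrow> ennreal"
  assumes [measurable]: "\<And>n. u n \<in> borel_measurable M"
    and lim: "AE x in M. (\<lambda>n. u n x) \<longlonglongrightarrow> v x"
    and le: "eventually (\<lambda>n. (\<integral>\<^sup>+x. u n x \<partial>M) \<le> C) sequentially"
  shows "(\<integral>\<^sup>+x. v x \<partial>M) \<le> C"
proof -
  have "(\<integral>\<^sup>+x. v x \<partial>M) = (\<integral>\<^sup>+x. liminf (\<lambda>n. u n x) \<partial>M)"
    using lim by (intro nn_integral_cong_AE) (auto simp: lim_imp_Liminf elim!: eventually_mono)
  also have "\<dots> \<le> liminf (\<lambda>n. \<integral>\<^sup>+x. u n x \<partial>M)" by (rule nn_integral_liminf) measurable
  also have "\<dots> \<le> liminf (\<lambda>n. C)" by (rule Liminf_mono[OF le])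
  finally show ?thesis by (simp add: Liminf_const)
qed

lemma nn_integral_normal_density: "s > 0 \<Longrightarrow> (\<integral>\<^sup>+x. ennreal (normal_density m s x) \<partial>lborel) = 1"
  by (subst nn_integral_eq_integral) auto

text \<open>Schur's test: 2 a(x) a(y) <= a(x)^2 + a(y)^2, and the kernel has mass 1 in each
  variable, so each square contributes the right-hand side once.\<close>

lemma nn_integral_gaussian_form_le:
  fixes a :: "real \<Rightarrow> ennreal"
  assumes [measurable]: "a \<in> borel_measurable borel" and s: "s > 0"
  shows "(\<integral>\<^sup>+x. a x * (\<integral>\<^sup>+y. a y * ennreal (normal_density 0 s (y - x)) \<partial>lborel) \<partial>lborel)
    \<le> (\<integral>\<^sup>+x. (a x)\<^sup>2 \<partial>lborel)"
proof -
  define N where "N = (\<lambda>x y. ennreal (normal_density 0 s (y - x)))"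
  have [measurable]: "case_prod N \<in> borel_measurable (borel \<Otimes>\<^sub>M borel)" unfolding N_def by measurable
  have [measurable]: "N x \<in> borel_measurable borel" for x unfolding N_def by measurable
  have N1: "(\<integral>\<^sup>+y. N x y \<partial>lborel) = 1" for x
  proof -
    have "N x y = ennreal (normal_density x s y)" for y by (simp add: N_def normal_density_def)
    thus ?thesis using nn_integral_normal_density[OF s, of x] by simp
  qed
  have N2: "(\<integral>\<^sup>+x. N x y \<partial>lborel) = 1" for y
  proof -
    have "N x y = ennreal (normal_density y s x)" for x by (simp add: N_def normal_density_def power2_commute)
    thus ?thesis using nn_integral_normal_density[OF s, of y] by simp
  qed
  have "2 * (\<integral>\<^sup>+x. a x * (\<integral>\<^sup>+y. a y * N x y \<partial>lborel) \<partial>lborel) =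
      (\<integral>\<^sup>+x. \<integral>\<^sup>+y. 2 * a x * a y * N x y \<partial>lborel \<partial>lborel)"
    by (simp add: nn_integral_cmult mult.assoc)
  also have "\<dots> \<le> (\<integral>\<^sup>+x. \<integral>\<^sup>+y. ((a x)\<^sup>2 + (a y)\<^sup>2) * N x y \<partial>lborel \<partial>lborel)"
    by (intro nn_integral_mono mult_right_mono sum_of_squares_ge_ennreal) auto
  also have "\<dots> = (\<integral>\<^sup>+x. (\<integral>\<^sup>+y. (a x)\<^sup>2 * N x y \<partial>lborel) + (\<integral>\<^sup>+y. (a y)\<^sup>2 * N x y \<partial>lborel) \<partial>lborel)"
    by (simp add: distrib_right nn_integral_add)
  also have "\<dots> = (\<integral>\<^sup>+x. \<integral>\<^sup>+y. (a x)\<^sup>2 * N x y \<partial>lborel \<partial>lborel) + (\<integral>\<^sup>+x. \<integral>\<^sup>+y. (a y)\<^sup>2 * N x y \<partial>lborel \<partial>lborel)"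
    by (intro nn_integral_add) measurable
  also have "(\<integral>\<^sup>+x. \<integral>\<^sup>+y. (a x)\<^sup>2 * N x y \<partial>lborel \<partial>lborel) = (\<integral>\<^sup>+x. (a x)\<^sup>2 \<partial>lborel)"
    by (simp add: nn_integral_cmult N1)
  also have "(\<integral>\<^sup>+x. \<integral>\<^sup>+y. (a y)\<^sup>2 * N x y \<partial>lborel \<partial>lborel) = (\<integral>\<^sup>+y. \<integral>\<^sup>+x. (a y)\<^sup>2 * N x y \<partial>lborel \<partial>lborel)"
    by (rule lborel_pair.Fubini') measurable
  also have "\<dots> = (\<integral>\<^sup>+x. (a x)\<^sup>2 \<partial>lborel)"
    by (simp add: nn_integral_cmult N2)
  finally have "2 * (\<integral>\<^sup>+x. a x * (\<integral>\<^sup>+y. a y * N x y \<partial>lborel) \<partial>lborel) \<le> 2 * (\<integral>\<^sup>+x. (a x)\<^sup>2 \<partial>lborel)"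
    by (simp add: mult_2)
  thus ?thesis unfolding N_def by (subst (asm) ennreal_mult_le_mult_iff) auto
qed

(* Applying the multiplication formula twice turns the Gaussian-weighted energy of the transform
   into the quadratic form of h against a Gaussian kernel of total mass 1. *)
lemma nn_integral_gaussian_fourier_integral_le:
  fixes h :: "real \<Rightarrow> complex"
  assumes h: "integrable lborel h" and s: "s > 0"
  defines "g \<equiv> \<lambda>\<xi>. exp (- (2 * pi * s * \<xi>)\<^sup>2 / 2)"
  shows "(\<integral>\<^sup>+\<xi>. ennreal ((norm (fourier_integral h \<xi>))\<^sup>2 * g \<xi>) \<partial>lborel) \<le> (\<integral>\<^sup>+x. ennreal ((norm (h x))\<^sup>2) \<partial>lborel)"
proof -
  have [measurable]: "h \<in> borel_measurable borel" using h by auto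
  have [measurable]: "cnj \<in> borel_measurable borel"
    by (intro borel_measurable_continuous_onI continuous_intros)
  have [measurable]: "g \<in> borel_measurable borel" unfolding g_def by measurable
  define H where "H = fourier_integral h"
  have [measurable]: "H \<in> borel_measurable borel" unfolding H_def by measurable
  define B where "B = (LINT x|lborel. norm (h x))"
  have HB: "norm (H \<xi>) \<le> B" for \<xi> unfolding H_def B_def by (rule norm_fourier_integral_le) measurable
  have g: "integrable lborel (\<lambda>\<xi>. complex_of_real (g \<xi>))"
    unfolding g_def using s by (intro integrable_of_real integrable_gaussian_exp)
  \<comment> \<open>Chosen so that \<open>H\<close> times \<open>u\<close> is the weighted energy
    |H|^2 g. The transform \<open>H\<close> is so far only known to be bounded, and the Gaussian
    supplies the integrability.\<close>
  define u where "u = (\<lambda>\<xi>. of_real (g \<xi>) * cnj (H \<xi>))"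
  have u: "integrable lborel u"
    unfolding u_def
  proof (intro integrable_times_bounded[where C = B] g)
    show "(\<lambda>\<xi>. cnj (H \<xi>)) \<in> borel_measurable lborel" by measurable
  qed (use HB in auto)
  have [measurable]: "u \<in> borel_measurable borel" using u by auto
  have uhat: "fourier_integral u x = cnj (LINT y|lborel. h y * of_real (normal_density 0 s (y - x)))" for x
  proof -
    define m where "m = (\<lambda>\<xi>. of_real (g \<xi>) * exp (2 * of_real pi * \<i> * of_real x * of_real \<xi>))"
    have m: "integrable lborel m"
      unfolding m_def by (intro integrable_times_bounded[where C = 1] g) (auto simp: norm_exp_eq_Re)
    have "fourier_integral u x = (LINT \<xi>|lborel. cnj (H \<xi> * m \<xi>))"
      unfolding fourier_integral_lborel[OF \<open>u \<in> borel_measurable borel\<close>]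
      by (intro Bochner_Integration.integral_cong refl) (simp add: u_def m_def exp_cnj mult_ac)
    also have "\<dots> = cnj (LINT \<xi>|lborel. H \<xi> * m \<xi>)" by (rule Bochner_Integration.integral_cnj)
    also have "(LINT \<xi>|lborel. H \<xi> * m \<xi>) = (LINT y|lborel. h y * fourier_integral m y)"
      unfolding H_def by (rule fourier_multiplication_formula[OF h m])
    also have "fourier_integral m = (\<lambda>y. of_real (normal_density 0 s (y - x)))"
      unfolding m_def g_def using fourier_integral_gaussian[OF s] by blast
    finally show ?thesis .
  qed
  have eq: "H \<xi> * u \<xi> = complex_of_real ((norm (H \<xi>))\<^sup>2 * g \<xi>)" for \<xi>
    unfolding u_def by (simp add: complex_norm_square mult_ac del: of_real_power)
  have "integrable lborel (\<lambda>\<xi>. u \<xi> * H \<xi>)" by (intro integrable_times_bounded[where C = B] u HB) auto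
  hence "integrable lborel (\<lambda>\<xi>. complex_of_real ((norm (H \<xi>))\<^sup>2 * g \<xi>))" unfolding eq[symmetric] by (simp add: mult.commute)
  hence int: "integrable lborel (\<lambda>\<xi>. (norm (H \<xi>))\<^sup>2 * g \<xi>)" unfolding complex_of_real_integrable_eq by simp
  have g0: "g \<xi> \<ge> 0" for \<xi> by (simp add: g_def)
  have "(\<integral>\<^sup>+\<xi>. ennreal ((norm (H \<xi>))\<^sup>2 * g \<xi>) \<partial>lborel) = ennreal (LINT \<xi>|lborel. (norm (H \<xi>))\<^sup>2 * g \<xi>)"
    using int g0 by (intro nn_integral_eq_integral) auto
  also have "\<dots> = ennreal (norm (LINT \<xi>|lborel. H \<xi> * u \<xi>))"
    unfolding eq integral_complex_of_real norm_of_real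
    using g0 by (simp add: integral_nonneg_AE)
  also have "(LINT \<xi>|lborel. H \<xi> * u \<xi>) = (LINT x|lborel. h x * fourier_integral u x)"
    unfolding H_def by (rule fourier_multiplication_formula[OF h u])
  also have "ennreal (norm \<dots>) \<le> (\<integral>\<^sup>+x. norm (h x * fourier_integral u x) \<partial>lborel)"
    by (intro integral_norm_bound_ennreal integrable_times_bounded[OF h _ norm_fourier_integral_le]) measurable
  also have "\<dots> \<le> (\<integral>\<^sup>+x. ennreal (norm (h x)) * (\<integral>\<^sup>+y. ennreal (norm (h y)) * ennreal (normal_density 0 s (y - x)) \<partial>lborel) \<partial>lborel)"
  proof (intro nn_integral_mono)
    fix x
    have nd: "normal_density 0 s t \<le> 1 / sqrt (2 * pi * s\<^sup>2)" for t
      using s by (auto simp: normal_density_def intro!: mult_left_le divide_right_mono)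
    have "ennreal (norm (fourier_integral u x)) \<le> (\<integral>\<^sup>+y. ennreal (norm (h y * of_real (normal_density 0 s (y - x)))) \<partial>lborel)"
      unfolding uhat complex_mod_cnj
      by (intro integral_norm_bound_ennreal integrable_times_bounded[OF h, where C = "1 / sqrt (2 * pi * s\<^sup>2)"]) (use nd in auto)
    thus "ennreal (norm (h x * fourier_integral u x)) \<le>
      ennreal (norm (h x)) * (\<integral>\<^sup>+y. ennreal (norm (h y)) * ennreal (normal_density 0 s (y - x)) \<partial>lborel)"
      unfolding norm_mult by (simp add: ennreal_mult mult_left_mono)
  qed
  also have "\<dots> \<le> (\<integral>\<^sup>+x. (ennreal (norm (h x)))\<^sup>2 \<partial>lborel)"
    by (rule nn_integral_gaussian_form_le[OF _ s]) measurable
  finally show ?thesis by (simp add: H_def ennreal_power)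
qed

text \<open>The Gaussian weights increase to 1 as s decreases to 0, while the bound does not depend
  on s. For h in L1 outside L2 the right-hand side is infinite.\<close>

lemma nn_integral_fourier_integral_le:
  fixes h :: "real \<Rightarrow> complex"
  assumes h: "integrable lborel h"
  shows "(\<integral>\<^sup>+\<xi>. ennreal ((norm (fourier_integral h \<xi>))\<^sup>2) \<partial>lborel) \<le> (\<integral>\<^sup>+x. ennreal ((norm (h x))\<^sup>2) \<partial>lborel)"
proof (rule nn_integral_le_of_tendsto)
  define s where "s = (\<lambda>n. inverse (real (Suc n)))"
  define u where "u = (\<lambda>n \<xi>. ennreal ((norm (fourier_integral h \<xi>))\<^sup>2 * exp (- (2 * pi * s n * \<xi>)\<^sup>2 / 2)))"
  have [measurable]: "h \<in> borel_measurable borel" using h by auto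
  show "u n \<in> borel_measurable lborel" for n unfolding u_def by measurable
  have s0: "s \<longlonglongrightarrow> 0" unfolding s_def by (rule LIMSEQ_inverse_real_of_nat)
  have "(\<lambda>n. (norm (fourier_integral h \<xi>))\<^sup>2 * exp (- (2 * pi * s n * \<xi>)\<^sup>2 / 2)) \<longlonglongrightarrow>
     (norm (fourier_integral h \<xi>))\<^sup>2 * exp (- (2 * pi * 0 * \<xi>)\<^sup>2 / 2)" for \<xi>
    by (intro tendsto_intros s0) auto
  thus "AE \<xi> in lborel. (\<lambda>n. u n \<xi>) \<longlonglongrightarrow> ennreal ((norm (fourier_integral h \<xi>))\<^sup>2)"
    unfolding u_def by (intro AE_I2 tendsto_ennrealI) simp
  show "eventually (\<lambda>n. (\<integral>\<^sup>+\<xi>. u n \<xi> \<partial>lborel) \<le> (\<integral>\<^sup>+x. ennreal ((norm (h x))\<^sup>2) \<partial>lborel)) sequentially"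
    unfolding u_def by (intro always_eventually allI nn_integral_gaussian_fourier_integral_le h) (simp add: s_def)
qed

section \<open>Existence of the L2 Fourier transform\<close>

context
  fixes f :: "real \<Rightarrow> complex"
  assumes f_borel [measurable]: "f \<in> borel_measurable borel"
    and f_L2: "integrable lborel (\<lambda>x. (norm (f x))\<^sup>2)"
begin

lemma integrable_truncated_L2: "integrable lborel (\<lambda>x. indicator {-R..R} x *\<^sub>R f x)"
proof (rule Bochner_Integration.integrable_bound)
  show "integrable lborel (\<lambda>x::real. indicator {-R..R} x + (norm (f x))\<^sup>2)"
    by (intro Bochner_Integration.integrable_add f_L2 integrable_real_indicator)
       (auto simp: emeasure_lborel_Icc_eq)
  have "t \<le> 1 + t\<^sup>2" for t :: real
    using sum_squares_bound[of t 1] zero_le_power2[of t] unfolding mult_1_right power_one by linarith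
  thus "AE x in lborel. norm (indicator {-R..R} x *\<^sub>R f x) \<le> norm (indicator {-R..R} x + (norm (f x))\<^sup>2)"
    by (intro AE_I2) (auto simp: indicator_def)
qed measurable

private definition F :: "real \<Rightarrow> real \<Rightarrow> complex" where
  "F R = fourier_integral (\<lambda>x. indicator {-R..R} x *\<^sub>R f x)"

private lemma F_measurable [measurable]: "F R \<in> borel_measurable borel"
  unfolding F_def by measurable

private definition tail :: "real \<Rightarrow> real" where
  "tail R = (LINT x|lborel. indicator {x. \<bar>x\<bar> > R} x * (norm (f x))\<^sup>2)"

private lemma integrable_tail: "integrable lborel (\<lambda>x. indicator {x. \<bar>x\<bar> > R} x * (norm (f x))\<^sup>2)"
  by (rule Bochner_Integration.integrable_bound[OF f_L2]) (auto simp: indicator_def)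

private lemma tail_tendsto_0: "(tail \<longlongrightarrow> 0) at_top"
proof -
  have "((\<lambda>R. LINT x|lborel. indicator {x. \<bar>x\<bar> > R} x * (norm (f x))\<^sup>2) \<longlongrightarrow> (LINT x|(lborel::real measure). (0::real))) at_top"
  proof (rule integral_dominated_convergence_at_top[OF _ _ f_L2])
    show "AE x in lborel. ((\<lambda>R. indicator {x. \<bar>x\<bar> > R} x * (norm (f x))\<^sup>2) \<longlongrightarrow> 0) at_top"
    proof (intro AE_I2 tendsto_eventually)
      fix x
      show "eventually (\<lambda>R. indicator {x. \<bar>x\<bar> > R} x * (norm (f x))\<^sup>2 = 0) at_top"
        using eventually_ge_at_top[of "\<bar>x\<bar>"] by eventually_elim (simp add: indicator_def)
    qed
    show "eventually (\<lambda>R. AE x in lborel. norm (indicator {x. \<bar>x\<bar> > R} x * (norm (f x))\<^sup>2) \<le> (norm (f x))\<^sup>2) at_top"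
      by (intro always_eventually allI AE_I2) (simp add: indicator_def)
  qed measurable
  thus ?thesis unfolding tail_def by simp
qed

text \<open>By linearity the difference is the transform of f restricted to S < |x| <= R, so
  Plancherel's inequality bounds it by the tail. The bound does not involve R, which gives the
  Cauchy property as R grows.\<close>

private lemma F_dist_le:
  assumes "S \<le> R"
  shows "(\<integral>\<^sup>+\<xi>. ennreal ((norm (F R \<xi> - F S \<xi>))\<^sup>2) \<partial>lborel) \<le> ennreal (tail S)"
proof -
  define h where "h = (\<lambda>x. indicator {-R..R} x *\<^sub>R f x - indicator {-S..S} x *\<^sub>R f x)"
  have h: "integrable lborel h"
    unfolding h_def by (intro Bochner_Integration.integrable_diff integrable_truncated_L2)
  have [measurable]: "h \<in> borel_measurable borel" using h by auto
  have eq: "F R \<xi> - F S \<xi> = fourier_integral h \<xi>" for \<xi>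
  proof -
    define e where "e = (\<lambda>x. exp (- 2 * complex_of_real pi * \<i> * of_real x * of_real \<xi>))"
    have i: "integrable lborel (\<lambda>x. (indicator {-R..R} x *\<^sub>R f x) * e x)" for R
      unfolding e_def by (intro integrable_times_bounded[where C = 1] integrable_truncated_L2) auto
    have F_eq: "F R \<xi> = (LINT x|lborel. (indicator {-R..R} x *\<^sub>R f x) * e x)" for R
      unfolding F_def e_def by (rule fourier_integral_lborel) measurable
    have "fourier_integral h \<xi> = (LINT x|lborel. h x * e x)"
      unfolding e_def by (rule fourier_integral_lborel) measurable
    also have "\<dots> = F R \<xi> - F S \<xi>"
      unfolding F_eq h_def left_diff_distrib by (rule Bochner_Integration.integral_diff[OF i i])
    finally show ?thesis ..
  qed
  have "(\<integral>\<^sup>+\<xi>. ennreal ((norm (F R \<xi> - F S \<xi>))\<^sup>2) \<partial>lborel) \<le> (\<integral>\<^sup>+x. ennreal ((norm (h x))\<^sup>2) \<partial>lborel)"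
    unfolding eq by (rule nn_integral_fourier_integral_le[OF h])
  also have "\<dots> \<le> (\<integral>\<^sup>+x. ennreal (indicator {x. \<bar>x\<bar> > S} x * (norm (f x))\<^sup>2) \<partial>lborel)"
    using assms by (intro nn_integral_mono ennreal_leI) (auto simp: h_def indicator_def)
  also have "\<dots> = ennreal (tail S)"
    unfolding tail_def by (intro nn_integral_eq_integral integrable_tail) auto
  finally show ?thesis .
qed

(* Along a subsequence whose tails decay like 16^-j, the sum of 4^j times the squared L2 distances
   of consecutive transforms is finite, so it converges almost everywhere pointwise. *)
private lemma exists_AE_limit:
  obtains r :: "nat \<Rightarrow> real" and g where "filterlim r at_top sequentially" "g \<in> borel_measurable borel"
    "AE \<xi> in lborel. (\<lambda>j. F (r j) \<xi>) \<longlonglongrightarrow> g \<xi>"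
proof -
  have "\<exists>q. \<forall>R\<ge>q. tail R < (1/16) ^ j" for j :: nat
    using order_tendstoD(2)[OF tail_tendsto_0, of "(1/16) ^ j"] unfolding eventually_at_top_linorder by simp
  then obtain q where q: "\<And>j R. R \<ge> q j \<Longrightarrow> tail R < (1/16) ^ j" by metis
  \<comment> \<open>Summing the |q i| makes \<open>r\<close> monotone and at least
    \<open>q j\<close>; the summand j forces it to infinity.\<close>
  define r where "r = (\<lambda>j. real j + (\<Sum>i\<le>j. \<bar>q i\<bar>))"
  have r_mono: "r j \<le> r (Suc j)" for j by (simp add: r_def)
  have r_ge: "r j \<ge> q j" for j
  proof -
    have "\<bar>q j\<bar> \<le> (\<Sum>i\<le>j. \<bar>q i\<bar>)" by (intro member_le_sum) auto
    thus ?thesis unfolding r_def by linarith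
  qed
  have r_lim: "filterlim r at_top sequentially"
    by (rule filterlim_at_top_mono[OF filterlim_real_sequentially])
       (auto simp: r_def intro!: always_eventually sum_nonneg)
  define d where "d = (\<lambda>j \<xi>. F (r (Suc j)) \<xi> - F (r j) \<xi>)"
  have [measurable]: "d j \<in> borel_measurable borel" for j unfolding d_def by measurable
  have "(\<integral>\<^sup>+\<xi>. (\<Sum>j. ennreal (4 ^ j * (norm (d j \<xi>))\<^sup>2)) \<partial>lborel) =
      (\<Sum>j. \<integral>\<^sup>+\<xi>. ennreal (4 ^ j * (norm (d j \<xi>))\<^sup>2) \<partial>lborel)"
    by (rule nn_integral_suminf) measurable
  also have "\<dots> \<le> (\<Sum>j. ennreal ((1/4) ^ j))"
  proof (intro suminf_le summableI)
    fix j
    have "(\<integral>\<^sup>+\<xi>. ennreal (4 ^ j * (norm (d j \<xi>))\<^sup>2) \<partial>lborel) = 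
       ennreal (4 ^ j) * (\<integral>\<^sup>+\<xi>. ennreal ((norm (d j \<xi>))\<^sup>2) \<partial>lborel)"
      by (simp add: ennreal_mult nn_integral_cmult)
    also have "\<dots> \<le> ennreal (4 ^ j) * ennreal ((1/16) ^ j)"
      unfolding d_def using F_dist_le[OF r_mono[of j]] q[OF r_ge[of j]]
      by (intro mult_left_mono) (auto intro: order_trans ennreal_leI)
    also have "\<dots> = ennreal ((1/4) ^ j)"
    proof -
      have "4 ^ j * (1/16::real) ^ j = (1/4) ^ j" unfolding power_mult_distrib[symmetric] by simp
      thus ?thesis by (simp flip: ennreal_mult')
    qed
    finally show "(\<integral>\<^sup>+\<xi>. ennreal (4 ^ j * (norm (d j \<xi>))\<^sup>2) \<partial>lborel) \<le> ennreal ((1/4) ^ j)" .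
  qed
  also have "\<dots> = ennreal (\<Sum>j. (1/4) ^ j)"
    by (intro suminf_ennreal2 summable_geometric) auto
  finally have "(\<integral>\<^sup>+\<xi>. (\<Sum>j. ennreal (4 ^ j * (norm (d j \<xi>))\<^sup>2)) \<partial>lborel) \<noteq> \<infinity>"
    by (auto simp: top_unique)
  hence "AE \<xi> in lborel. (\<Sum>j. ennreal (4 ^ j * (norm (d j \<xi>))\<^sup>2)) \<noteq> \<infinity>"
    by (intro nn_integral_PInf_AE) measurable
  hence conv: "AE \<xi> in lborel. convergent (\<lambda>j. F (r j) \<xi>)"
  proof eventually_elim
    case (elim \<xi>)
    have s: "summable (\<lambda>j. (1/4) ^ j + 4 ^ j * (norm (d j \<xi>))\<^sup>2)"
      using elim by (intro summable_add summable_geometric summable_suminf_not_top) auto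
    have "norm (d j \<xi>) \<le> (1/4) ^ j + 4 ^ j * (norm (d j \<xi>))\<^sup>2" for j
    proof -
      \<comment> \<open>The arithmetic-geometric mean inequality with 1 = 2^-j 2^j trades the
        squared norms, whose weighted sum is finite, for the norms themselves, at the cost of a
        geometric series.\<close>
      have "2 * ((1/2) ^ j * (2 ^ j * norm (d j \<xi>))) \<le> ((1/2) ^ j)\<^sup>2 + (2 ^ j * norm (d j \<xi>))\<^sup>2"
        using sum_squares_bound[of "(1/2) ^ j" "2 ^ j * norm (d j \<xi>)"] by (simp add: mult.assoc)
      also have "(1/2) ^ j * (2 ^ j * norm (d j \<xi>)) = norm (d j \<xi>)"
      proof -
        have "(1/2::real) ^ j * 2 ^ j = 1" unfolding power_mult_distrib[symmetric] by simp
        thus ?thesis by (simp only: mult.assoc[symmetric] mult_1)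
      qed
      also have "((1/2) ^ j)\<^sup>2 + (2 ^ j * norm (d j \<xi>))\<^sup>2 = (1/4) ^ j + 4 ^ j * (norm (d j \<xi>))\<^sup>2"
      proof -
        have "((1/2::real) ^ j)\<^sup>2 = (1/4) ^ j" "((2::real) ^ j)\<^sup>2 = 4 ^ j"
          unfolding power2_eq_square by (simp_all flip: power_mult_distrib)
        thus ?thesis by (simp only: power_mult_distrib)
      qed
      finally show ?thesis using norm_ge_zero[of "d j \<xi>"] by linarith
    qed
    hence "summable (\<lambda>j. d j \<xi>)" by (intro summable_comparison_test'[OF s]) auto
    hence "(\<lambda>n. F (r 0) \<xi> + (\<Sum>j<n. d j \<xi>)) \<longlonglongrightarrow> F (r 0) \<xi> + (\<Sum>j. d j \<xi>)"
      by (intro tendsto_add tendsto_const summable_LIMSEQ)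
    also have "(\<lambda>n. F (r 0) \<xi> + (\<Sum>j<n. d j \<xi>)) = (\<lambda>n. F (r n) \<xi>)"
      using sum_lessThan_telescope[of "\<lambda>j. F (r j) \<xi>"] by (simp add: d_def)
    finally show ?case by (rule convergentI)
  qed
  show ?thesis
  proof (rule that[OF r_lim])
    show "(\<lambda>\<xi>. lim (\<lambda>j. F (r j) \<xi>)) \<in> borel_measurable borel" by measurable
    show "AE \<xi> in lborel. (\<lambda>j. F (r j) \<xi>) \<longlonglongrightarrow> lim (\<lambda>j. F (r j) \<xi>)"
      using conv by eventually_elim (simp add: convergent_LIMSEQ_iff)
  qed
qed

text \<open>The limit g is found along a subsequence only. Fatou's lemma, applied to the distances
  from a fixed \<open>F R\<close>, bounds the distance from g to \<open>F R\<close> by the tail for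
  every real R, so the whole family converges.\<close>

lemma has_L2_fourier_exists: "\<exists>g. has_L2_fourier f g"
proof -
  obtain r :: "nat \<Rightarrow> real" and g where r: "filterlim r at_top sequentially"
    and g [measurable]: "g \<in> borel_measurable borel"
    and lim: "AE \<xi> in lborel. (\<lambda>j. F (r j) \<xi>) \<longlonglongrightarrow> g \<xi>"
    by (rule exists_AE_limit)
  have dist: "(\<integral>\<^sup>+\<xi>. ennreal ((norm (g \<xi> - F R \<xi>))\<^sup>2) \<partial>lborel) \<le> ennreal (tail R)" for R
  proof (rule nn_integral_le_of_tendsto)
    show "AE \<xi> in lborel. (\<lambda>j. ennreal ((norm (F (r j) \<xi> - F R \<xi>))\<^sup>2)) \<longlonglongrightarrow> ennreal ((norm (g \<xi> - F R \<xi>))\<^sup>2)"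
      using lim by eventually_elim (intro tendsto_intros)
    show "eventually (\<lambda>j. (\<integral>\<^sup>+\<xi>. ennreal ((norm (F (r j) \<xi> - F R \<xi>))\<^sup>2) \<partial>lborel) \<le> ennreal (tail R)) sequentially"
      using r[unfolded filterlim_at_top, rule_format, of R] by eventually_elim (rule F_dist_le)
  qed measurable
  have "(\<integral>\<^sup>+\<xi>. ennreal ((norm (g \<xi>))\<^sup>2) \<partial>lborel) \<le> (\<integral>\<^sup>+x. ennreal ((norm (f x))\<^sup>2) \<partial>lborel)"
  proof (rule nn_integral_le_of_tendsto)
    show "AE \<xi> in lborel. (\<lambda>j. ennreal ((norm (F (r j) \<xi>))\<^sup>2)) \<longlonglongrightarrow> ennreal ((norm (g \<xi>))\<^sup>2)"
      using lim by eventually_elim (intro tendsto_intros)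
    have "(\<integral>\<^sup>+\<xi>. ennreal ((norm (F R \<xi>))\<^sup>2) \<partial>lborel) \<le> (\<integral>\<^sup>+x. ennreal ((norm (f x))\<^sup>2) \<partial>lborel)" for R
      unfolding F_def
      by (rule order_trans[OF nn_integral_fourier_integral_le[OF integrable_truncated_L2]])
         (intro nn_integral_mono ennreal_leI, simp add: indicator_def)
    thus "eventually (\<lambda>j. (\<integral>\<^sup>+\<xi>. ennreal ((norm (F (r j) \<xi>))\<^sup>2) \<partial>lborel) \<le> (\<integral>\<^sup>+x. ennreal ((norm (f x))\<^sup>2) \<partial>lborel)) sequentially"
      by (intro always_eventually allI)
  qed measurable
  also have "\<dots> < \<infinity>" using f_L2 by (subst nn_integral_eq_integral) auto
  finally have "integrable lborel (\<lambda>\<xi>. (norm (g \<xi>))\<^sup>2)" by (intro integrableI_nonneg) auto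
  hence "L2_fun g" unfolding L2_fun_def by (simp add: integrable_completion measurable_completion)
  moreover have "((\<lambda>R. \<integral>\<^sup>+\<xi>. ennreal ((norm (g \<xi> - F R \<xi>))\<^sup>2) \<partial>lborel) \<longlongrightarrow> 0) at_top"
  proof (rule tendsto_sandwich[where f = "\<lambda>_. 0" and h = "\<lambda>R. ennreal (tail R)"])
    show "((\<lambda>R. ennreal (tail R)) \<longlongrightarrow> 0) at_top"
      using tendsto_ennrealI[OF tail_tendsto_0] by simp
    show "((\<lambda>R::real. 0::ennreal) \<longlongrightarrow> 0) at_top" by simp
  qed (simp_all add: dist)
  ultimately have "has_L2_fourier f g"
    unfolding has_L2_fourier_def F_def nn_integral_completion by simp
  thus ?thesis by blast
qed

end

section \<open>The sinc kernel as a Fourier integral\<close>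

lemma borel_measurable_normalized_sinc [measurable]: "normalized_sinc \<in> borel_measurable borel"
  unfolding normalized_sinc_def by measurable

lemma abs_normalized_sinc_le: "\<bar>normalized_sinc u\<bar> \<le> 2 / (1 + \<bar>u\<bar>)"
proof (cases "\<bar>u\<bar> \<le> 1")
  case True
  have "\<bar>sin (pi * u)\<bar> \<le> \<bar>pi * u\<bar>" by (rule abs_sin_x_le_abs_x)
  hence "\<bar>normalized_sinc u\<bar> \<le> 1" by (auto simp: normalized_sinc_def divide_le_eq abs_mult)
  also have "1 \<le> 2 / (1 + \<bar>u\<bar>)" using True by (simp add: field_simps)
  finally show ?thesis .
next
  case False
  have "\<bar>sin (pi * u)\<bar> / (pi * \<bar>u\<bar>) \<le> 1 / \<bar>u\<bar>"
    using False pi_ge_two order_trans[OF abs_sin_le_one[of "pi * u"], of pi] by (simp add: field_simps)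
  also have "\<dots> \<le> 2 / (1 + \<bar>u\<bar>)" using False by (simp add: field_simps)
  finally show ?thesis using False by (auto simp: normalized_sinc_def abs_mult)
qed

text \<open>The band is built into the function, so that the set integrals of the theorem become
  integrals against an L1 function, to which the multiplication formula applies.\<close>

definition unit_band_character :: "real \<Rightarrow> real \<Rightarrow> complex" where
  "unit_band_character t \<xi> = indicator {-1/2..1/2} \<xi> *\<^sub>R exp (2 * of_real pi * \<i> * of_real \<xi> * of_real t)"

lemma borel_measurable_unit_band_character [measurable]: "unit_band_character t \<in> borel_measurable borel"
  unfolding unit_band_character_def by measurable

lemma norm_unit_band_character: "norm (unit_band_character t \<xi>) = indicator {-1/2..1/2} \<xi>"
  by (simp add: unit_band_character_def norm_exp_eq_Re)

lemma integrable_unit_band_character: "integrable lborel (unit_band_character t)"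
  by (rule Bochner_Integration.integrable_bound[of _ "indicator {-1/2..1/2} :: real \<Rightarrow> real"])
     (auto simp: norm_unit_band_character)

lemma fourier_integral_unit_band_character:
  "fourier_integral (unit_band_character t) x = of_real (normalized_sinc (x - t))"
proof -
  define u where "u = x - t"
  have "fourier_integral (unit_band_character t) x =
    (LINT \<xi>|lborel. indicator {-1/2..1/2} \<xi> *\<^sub>R exp (- 2 * of_real pi * \<i> * of_real u * of_real \<xi>))"
    by (subst fourier_integral_lborel, measurable)
       (auto simp: unit_band_character_def u_def algebra_simps simp flip: exp_add intro!: Bochner_Integration.integral_cong)
  also have "\<dots> = of_real (normalized_sinc u)"
  proof (cases "u = 0")
    case True
    thus ?thesis by (simp add: normalized_sinc_def)
  next
    case False
    define c where "c = - 2 * complex_of_real pi * \<i> * of_real u"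
    have c: "c \<noteq> 0" using False by (simp add: c_def)
    have "(LINT \<xi>|lborel. indicator {-1/2..1/2} \<xi> *\<^sub>R exp (c * of_real \<xi>)) =
      exp (c * of_real (1/2)) / c - exp (c * of_real (-1/2)) / c"
    proof (rule integral_FTC_atLeastAtMost)
      fix y :: real
      have "((\<lambda>z. exp (c * z) / c) has_field_derivative exp (c * of_real y)) (at (of_real y))"
        using c by (auto intro!: derivative_eq_intros)
      hence "((\<lambda>z. exp (c * of_real z) / c) has_vector_derivative exp (c * of_real y)) (at y)"
        by (rule has_vector_derivative_real_field)
      thus "((\<lambda>z. exp (c * of_real z) / c) has_vector_derivative exp (c * of_real y)) (at y within {-1/2..1/2})"
        by (rule has_vector_derivative_at_within)
    qed (auto intro!: continuous_intros)
    also have "\<dots> = of_real (normalized_sinc u)"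
    proof -
      have "complex_of_real (sin (pi * u)) = (exp (c * of_real (-1/2)) - exp (c * of_real (1/2))) / (2 * \<i>)"
        unfolding sin_of_real[symmetric] sin_exp_eq by (simp add: c_def mult_ac)
      hence "exp (c * of_real (1/2)) - exp (c * of_real (-1/2)) = - (2 * \<i>) * of_real (sin (pi * u))"
        by (simp add: field_simps)
      hence "exp (c * of_real (1/2)) / c - exp (c * of_real (-1/2)) / c = - (2 * \<i>) * of_real (sin (pi * u)) / c"
        by (simp only: diff_divide_distrib[symmetric])
      also have "\<dots> = of_real (normalized_sinc u)"
        using False by (simp add: c_def normalized_sinc_def)
      finally show ?thesis .
    qed
    finally show ?thesis by (simp add: c_def)
  qed
  finally show ?thesis by (simp add: u_def)
qed

section \<open>Integrating the sinc expansion\<close>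

lemma borel_measurable_gen_binomial [measurable]:
  "(\<lambda>x. gen_binomial w (complex_of_real x)) \<in> borel_measurable borel"
  unfolding gen_binomial_def by (intro borel_measurable_continuous_onI continuous_intros continuous_on_compose2[OF continuous_on_rGamma]) auto

text \<open>Dominated convergence for the partial sums. Weighted integrability of f is the single
  form in which both the L1 and the L2 hypothesis enter.\<close>

lemma sums_integral_gen_binomial:
  fixes f :: "real \<Rightarrow> complex"
  assumes w: "Re w > -1" and b: "0 \<le> b" "b < Re w + 1" "b < 1"
    and f [measurable]: "f \<in> borel_measurable borel"
    and int: "integrable lborel (\<lambda>x. (1 + \<bar>x\<bar>) powr (-b) * norm (f x))"
  shows "integrable lborel (\<lambda>x. f x * of_real (normalized_sinc (x - real k)))"
    and "integrable lborel (\<lambda>x. gen_binomial w (of_real x) * f x)"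
    and "(\<lambda>k. (w gchoose k) * (LINT x|lborel. f x * of_real (normalized_sinc (x - real k))))
      sums (LINT x|lborel. gen_binomial w (of_real x) * f x)"
proof -
  obtain C where C: "C > 0" "\<And>k. norm (w gchoose k) \<le> C * (1 + real k) powr (-(Re w + 1))"
    using norm_gbinomial_le_powr[OF w] by blast
  obtain M where M: "M > 0" "\<And>x N. (\<Sum>k<N. (1 + real k) powr (-(Re w + 1)) * (1 / (1 + \<bar>x - real k\<bar>))) \<le> M * (1 + \<bar>x\<bar>) powr (-b)"
    using sum_powr_mult_inverse_le_powr[OF b] by blast
  define s where "s = (\<lambda>N x. \<Sum>k<N. (w gchoose k) * (f x * of_real (normalized_sinc (x - real k))))"
  \<comment> \<open>The 2 comes from the sinc bound, \<open>C\<close> from the decay of the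
    binomials and \<open>M\<close> from the summation over k.\<close>
  define D where "D = (\<lambda>x. (2 * C * M) * ((1 + \<bar>x\<bar>) powr (-b) * norm (f x)))"
  have [measurable]: "s N \<in> borel_measurable borel" for N unfolding s_def by measurable
  have D: "integrable lborel D" unfolding D_def by (intro integrable_mult_right int)
  have bound: "norm (s N x) \<le> D x" for N x
  proof -
    have "norm (s N x) \<le> (\<Sum>k<N. norm ((w gchoose k) * (f x * of_real (normalized_sinc (x - real k)))))"
      unfolding s_def by (rule norm_sum)
    also have "\<dots> \<le> (\<Sum>k<N. (C * (1 + real k) powr (-(Re w + 1))) * (norm (f x) * (2 / (1 + \<bar>x - real k\<bar>))))"
      unfolding norm_mult norm_of_real using C
      by (intro sum_mono mult_mono abs_normalized_sinc_le order_refl) auto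
    also have "\<dots> = (2 * C * norm (f x)) * (\<Sum>k<N. (1 + real k) powr (-(Re w + 1)) * (1 / (1 + \<bar>x - real k\<bar>)))"
      unfolding sum_distrib_left by (simp add: mult_ac)
    also have "\<dots> \<le> (2 * C * norm (f x)) * (M * (1 + \<bar>x\<bar>) powr (-b))"
      using C by (intro mult_left_mono M) auto
    finally show ?thesis by (simp add: D_def mult_ac)
  qed
  have lim: "AE x in lborel. (\<lambda>N. s N x) \<longlonglongrightarrow> gen_binomial w (of_real x) * f x"
  proof -
    \<comment> \<open>The pointwise expansion is available off the integers, which form a null
      set.\<close>
    have "AE x in lborel. x \<notin> (\<int> :: real set)"
      by (intro AE_not_in countable_imp_null_set_lborel countable_int)
    thus ?thesis
    proof eventually_elim
      case (elim x)
      from sums_mult2[OF sums_gen_binomial_normalized_sinc[OF w elim], of "f x"]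
      show ?case unfolding sums_def s_def by (simp add: mult_ac)
    qed
  qed
  show "integrable lborel (\<lambda>x. gen_binomial w (of_real x) * f x)"
    by (rule integrable_dominated_convergence[OF _ _ D lim]) (use bound in auto)
  \<comment> \<open>For fixed k, 1 + |x| <= (1 + k)(1 + |x - k|) compares the sinc decay with (1 +
    |x|)^-1, and b < 1 weakens this to the weight at hand.\<close>
  have summand: "integrable lborel (\<lambda>x. f x * of_real (normalized_sinc (x - real k)))" for k
  proof (rule Bochner_Integration.integrable_bound)
    show "integrable lborel (\<lambda>x. (2 * (1 + real k)) * ((1 + \<bar>x\<bar>) powr (-b) * norm (f x)))"
      by (intro integrable_mult_right int)
    have "\<bar>normalized_sinc (x - real k)\<bar> \<le> 2 * (1 + real k) * (1 + \<bar>x\<bar>) powr (-b)" for x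
    proof -
      have "1 + \<bar>x\<bar> \<le> (1 + real k) * (1 + \<bar>x - real k\<bar>)"
      proof -
        have "0 \<le> real k * \<bar>x - real k\<bar>" by simp
        moreover have "\<bar>x\<bar> \<le> real k + \<bar>x - real k\<bar>" by linarith
        moreover have "(1 + real k) * (1 + \<bar>x - real k\<bar>) = 1 + real k + \<bar>x - real k\<bar> + real k * \<bar>x - real k\<bar>"
          by (simp add: algebra_simps)
        ultimately show ?thesis by linarith
      qed
      hence "2 / (1 + \<bar>x - real k\<bar>) \<le> 2 * (1 + real k) / (1 + \<bar>x\<bar>)" by (simp add: field_simps)
      also have "\<dots> = 2 * (1 + real k) * (1 + \<bar>x\<bar>) powr (-1)" by (simp add: powr_minus divide_inverse)
      also have "\<dots> \<le> 2 * (1 + real k) * (1 + \<bar>x\<bar>) powr (-b)"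
        using b by (intro mult_left_mono powr_mono) auto
      finally show ?thesis using abs_normalized_sinc_le[of "x - real k"] by linarith
    qed
    hence "norm (f x) * \<bar>normalized_sinc (x - real k)\<bar> \<le> norm (f x) * (2 * (1 + real k) * (1 + \<bar>x\<bar>) powr (-b))" for x
      by (intro mult_left_mono) auto
    thus "AE x in lborel. norm (f x * of_real (normalized_sinc (x - real k))) \<le>
        norm ((2 * (1 + real k)) * ((1 + \<bar>x\<bar>) powr (-b) * norm (f x)))"
      by (intro AE_I2) (simp add: norm_mult abs_mult mult_ac)
  qed measurable
  show "integrable lborel (\<lambda>x. f x * of_real (normalized_sinc (x - real k)))" by (rule summand)
  have "(\<lambda>N. LINT x|lborel. s N x) \<longlonglongrightarrow> (LINT x|lborel. gen_binomial w (of_real x) * f x)"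
    by (rule integral_dominated_convergence[OF _ _ D lim]) (use bound in auto)
  also have "(\<lambda>N. LINT x|lborel. s N x) =
      (\<lambda>N. \<Sum>k<N. (w gchoose k) * (LINT x|lborel. f x * of_real (normalized_sinc (x - real k))))"
    unfolding s_def using summand by (subst Bochner_Integration.integral_sum) auto
  finally show "(\<lambda>k. (w gchoose k) * (LINT x|lborel. f x * of_real (normalized_sinc (x - real k))))
      sums (LINT x|lborel. gen_binomial w (of_real x) * f x)" unfolding sums_def .
qed

section \<open>Band integrals of the transforms of L1 and L2 functions\<close>

lemma set_integral_unit_band:
  "(LINT \<xi>:{-1/2..1/2}|lebesgue. g \<xi> * exp (2 * of_real pi * \<i> * of_real \<xi> * of_nat k)) =
   (LINT \<xi>|lebesgue. g \<xi> * unit_band_character (real k) \<xi>)"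
  unfolding set_lebesgue_integral_def unit_band_character_def
  by (intro Bochner_Integration.integral_cong refl) (simp add: indicator_def)

lemma integral_fourier_integral_unit_band:
  assumes f: "integrable lborel f"
  shows "(LINT \<xi>|lebesgue. fourier_integral f \<xi> * unit_band_character t \<xi>) =
    (LINT x|lborel. f x * of_real (normalized_sinc (x - t)))"
proof -
  have [measurable]: "f \<in> borel_measurable borel" using f by auto
  have "(LINT \<xi>|lebesgue. fourier_integral f \<xi> * unit_band_character t \<xi>) =
     (LINT \<xi>|lborel. fourier_integral f \<xi> * unit_band_character t \<xi>)"
    by (intro integral_completion) measurable
  also have "\<dots> = (LINT x|lborel. f x * of_real (normalized_sinc (x - t)))"
    unfolding fourier_multiplication_formula[OF f integrable_unit_band_character]
      fourier_integral_unit_band_character ..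
  finally show ?thesis .
qed

lemma integrable_L2_mult_unit_band:
  assumes "g \<in> borel_measurable lebesgue" "integrable lebesgue (\<lambda>\<xi>. (norm (g \<xi>))\<^sup>2)"
  shows "integrable lebesgue (\<lambda>\<xi>. g \<xi> * unit_band_character t \<xi>)"
proof (rule Bochner_Integration.integrable_bound)
  have m: "unit_band_character t \<in> borel_measurable lebesgue"
    by (intro measurable_completion) measurable
  show "(\<lambda>\<xi>. g \<xi> * unit_band_character t \<xi>) \<in> borel_measurable lebesgue"
    using assms(1) m by measurable
  show "integrable lebesgue (\<lambda>\<xi>. norm (unit_band_character t \<xi>) + (norm (g \<xi>))\<^sup>2)"
    by (intro Bochner_Integration.integrable_add integrable_norm assms)
       (simp add: integrable_completion integrable_unit_band_character)
  have "s \<le> 1 + s\<^sup>2" for s :: real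
    using sum_squares_bound[of s 1] zero_le_power2[of s] unfolding mult_1_right power_one by linarith
  thus "AE \<xi> in lebesgue. norm (g \<xi> * unit_band_character t \<xi>) \<le> norm (norm (unit_band_character t \<xi>) + (norm (g \<xi>))\<^sup>2)"
    by (intro AE_I2) (auto simp: norm_mult norm_unit_band_character indicator_def)
qed

text \<open>Cauchy-Schwarz against the band character, whose L2 norm is 1 because the band has
  length 1.\<close>

lemma norm_integral_unit_band_le:
  assumes g: "g \<in> borel_measurable lebesgue" and int: "integrable lebesgue (\<lambda>\<xi>. g \<xi> * unit_band_character t \<xi>)"
  shows "ennreal ((norm (LINT \<xi>|lebesgue. g \<xi> * unit_band_character t \<xi>))\<^sup>2) \<le> (\<integral>\<^sup>+\<xi>. ennreal ((norm (g \<xi>))\<^sup>2) \<partial>lebesgue)"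
proof -
  define m where "m = unit_band_character t"
  have m [measurable]: "m \<in> borel_measurable lebesgue"
    unfolding m_def by (intro measurable_completion) measurable
  note g [measurable]
  have "ennreal (norm (LINT \<xi>|lebesgue. g \<xi> * m \<xi>)) \<le> (\<integral>\<^sup>+\<xi>. ennreal (norm (g \<xi> * m \<xi>)) \<partial>lebesgue)"
    unfolding m_def by (rule integral_norm_bound_ennreal[OF int])
  also have "\<dots> = (\<integral>\<^sup>+\<xi>. ennreal (norm (g \<xi>)) * ennreal (norm (m \<xi>)) \<partial>lebesgue)"
    by (simp add: norm_mult ennreal_mult)
  finally have "(ennreal (norm (LINT \<xi>|lebesgue. g \<xi> * m \<xi>)))\<^sup>2 \<le> (\<integral>\<^sup>+\<xi>. ennreal (norm (g \<xi>)) * ennreal (norm (m \<xi>)) \<partial>lebesgue)\<^sup>2"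
    by (rule power_mono_ennreal)
  also have "\<dots> \<le> (\<integral>\<^sup>+\<xi>. (ennreal (norm (g \<xi>)))\<^sup>2 \<partial>lebesgue) * (\<integral>\<^sup>+\<xi>. (ennreal (norm (m \<xi>)))\<^sup>2 \<partial>lebesgue)"
    by (rule Cauchy_Schwarz_nn_integral) measurable
  also have "(\<integral>\<^sup>+\<xi>. (ennreal (norm (m \<xi>)))\<^sup>2 \<partial>lebesgue) = (\<integral>\<^sup>+\<xi>. indicator {-1/2..1/2::real} \<xi> \<partial>lebesgue)"
    unfolding m_def norm_unit_band_character by (intro nn_integral_cong) (auto simp: indicator_def)
  also have "\<dots> = 1" by (simp add: emeasure_lborel_Icc_eq)
  finally show ?thesis by (simp add: m_def ennreal_power)
qed

lemma integral_L2_fourier_unit_band: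
  assumes f [measurable]: "f \<in> borel_measurable borel" and f2: "integrable lborel (\<lambda>x. (norm (f x))\<^sup>2)"
    and g: "has_L2_fourier f g"
    and int: "integrable lborel (\<lambda>x. f x * of_real (normalized_sinc (x - t)))"
  shows "(LINT \<xi>|lebesgue. g \<xi> * unit_band_character t \<xi>) = (LINT x|lborel. f x * of_real (normalized_sinc (x - t)))"
proof -
  define h where "h = (\<lambda>R x. indicator {-R..R} x *\<^sub>R f x)"
  have h: "integrable lborel (h R)" for R
    unfolding h_def by (rule integrable_truncated_L2[OF f f2])
  have [measurable]: "h R \<in> borel_measurable borel" for R unfolding h_def by measurable
  have F: "fourier_integral (h R) \<in> borel_measurable lebesgue" for R
    by (intro measurable_completion) measurable
  have g': "g \<in> borel_measurable lebesgue" "integrable lebesgue (\<lambda>\<xi>. (norm (g \<xi>))\<^sup>2)"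
    and lim: "((\<lambda>R. \<integral>\<^sup>+\<xi>. ennreal ((norm (g \<xi> - fourier_integral (h R) \<xi>))\<^sup>2) \<partial>lebesgue) \<longlongrightarrow> 0) at_top"
    using g unfolding has_L2_fourier_def L2_fun_def h_def by auto
  define I where "I = (LINT \<xi>|lebesgue. g \<xi> * unit_band_character t \<xi>)"
  define J where "J = (\<lambda>R. LINT x|lborel. h R x * of_real (normalized_sinc (x - t)))"
  have diff: "ennreal ((norm (I - J R))\<^sup>2) \<le> (\<integral>\<^sup>+\<xi>. ennreal ((norm (g \<xi> - fourier_integral (h R) \<xi>))\<^sup>2) \<partial>lebesgue)" for R
  proof -
    have i: "integrable lebesgue (\<lambda>\<xi>. g \<xi> * unit_band_character t \<xi>)"
      by (rule integrable_L2_mult_unit_band[OF g'])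
    have "integrable lborel (\<lambda>\<xi>. unit_band_character t \<xi> * fourier_integral (h R) \<xi>)"
      by (intro integrable_times_bounded[OF integrable_unit_band_character _ norm_fourier_integral_le]) measurable
    hence j: "integrable lebesgue (\<lambda>\<xi>. fourier_integral (h R) \<xi> * unit_band_character t \<xi>)"
      by (subst integrable_completion) (simp_all add: mult.commute)
    have "I - J R = (LINT \<xi>|lebesgue. g \<xi> * unit_band_character t \<xi> - fourier_integral (h R) \<xi> * unit_band_character t \<xi>)"
      unfolding I_def J_def integral_fourier_integral_unit_band[OF h, symmetric]
      by (rule Bochner_Integration.integral_diff[OF i j, symmetric])
    also have "\<dots> = (LINT \<xi>|lebesgue. (g \<xi> - fourier_integral (h R) \<xi>) * unit_band_character t \<xi>)"
      by (simp only: left_diff_distrib)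
    finally have eq: "I - J R = (LINT \<xi>|lebesgue. (g \<xi> - fourier_integral (h R) \<xi>) * unit_band_character t \<xi>)" .
    show ?thesis unfolding eq
    proof (rule norm_integral_unit_band_le)
      show "(\<lambda>\<xi>. g \<xi> - fourier_integral (h R) \<xi>) \<in> borel_measurable lebesgue" using g'(1) F by measurable
      show "integrable lebesgue (\<lambda>\<xi>. (g \<xi> - fourier_integral (h R) \<xi>) * unit_band_character t \<xi>)"
        unfolding left_diff_distrib by (rule Bochner_Integration.integrable_diff[OF i j])
    qed
  qed
  have "((\<lambda>R. ennreal ((norm (I - J R))\<^sup>2)) \<longlongrightarrow> ennreal 0) at_top"
    unfolding ennreal_0
    by (rule tendsto_sandwich[OF always_eventually always_eventually tendsto_const lim]) (simp_all add: diff)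
  hence "((\<lambda>R. (norm (I - J R))\<^sup>2) \<longlongrightarrow> 0) at_top" by (subst (asm) tendsto_ennreal_iff) auto
  hence "((\<lambda>R. sqrt ((norm (I - J R))\<^sup>2)) \<longlongrightarrow> sqrt 0) at_top" by (rule tendsto_real_sqrt)
  hence "((\<lambda>R. I - J R) \<longlongrightarrow> 0) at_top" by (simp add: tendsto_norm_zero_iff)
  hence "((\<lambda>R. I - (I - J R)) \<longlongrightarrow> I - 0) at_top" by (intro tendsto_intros)
  hence "(J \<longlongrightarrow> I) at_top" by simp
  moreover have "(J \<longlongrightarrow> (LINT x|lborel. f x * of_real (normalized_sinc (x - t)))) at_top"
    unfolding J_def
  proof (rule integral_dominated_convergence_at_top[OF _ _ integrable_norm[OF int]])
    show "AE x in lborel. ((\<lambda>R. h R x * of_real (normalized_sinc (x - t))) \<longlongrightarrow> f x * of_real (normalized_sinc (x - t))) at_top"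
    proof (intro AE_I2 tendsto_eventually)
      fix x
      show "eventually (\<lambda>R. h R x * of_real (normalized_sinc (x - t)) = f x * of_real (normalized_sinc (x - t))) at_top"
        using eventually_ge_at_top[of "\<bar>x\<bar>"] by eventually_elim (auto simp: h_def indicator_def)
    qed
    show "eventually (\<lambda>R. AE x in lborel. norm (h R x * of_real (normalized_sinc (x - t))) \<le>
        norm (f x * of_real (normalized_sinc (x - t)))) at_top"
      by (intro always_eventually allI AE_I2) (simp add: h_def indicator_def)
  qed measurable
  ultimately show ?thesis unfolding I_def by (rule tendsto_unique[OF trivial_limit_at_top_linorder])
qed

section \<open>Weighted integrability of L2 functions\<close>

text \<open>A product of two nonnegative numbers is at most the sum of their squares, and (1 +
  |x|)^(-2b) is integrable because 2b > 1.\<close>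

lemma integrable_L2_times_powr:
  assumes f [measurable]: "f \<in> borel_measurable borel" and f2: "integrable lborel (\<lambda>x. (norm (f x))\<^sup>2)"
    and b: "b > 1/2"
  shows "integrable lborel (\<lambda>x. (1 + \<bar>x\<bar>) powr (-b) * norm (f x))"
proof (rule Bochner_Integration.integrable_bound)
  define p where "p = (\<lambda>x::real. (1 + \<bar>x\<bar>) powr (-2 * b))"
  have [measurable]: "p \<in> borel_measurable borel" unfolding p_def by measurable
  have p: "integrable lborel p"
  proof (rule Bochner_Integration.integrable_bound)
    \<comment> \<open>The half-line part has an explicit antiderivative; adding its reflection
      dominates \<open>p\<close> on the whole line.\<close>
    define q where "q = (\<lambda>x::real. (1 + x) powr (-2 * b) * indicator {0..} x)"
    have [measurable]: "q \<in> borel_measurable borel" unfolding q_def by measurable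
    have "(\<integral>\<^sup>+x. ennreal ((1 + x) powr (-2 * b)) * indicator {0..} x \<partial>lborel) =
       ennreal (0 - ((1 + 0) powr (1 - 2 * b) / (1 - 2 * b)))"
    proof (rule nn_integral_FTC_atLeast)
      fix x :: real assume x: "0 \<le> x"
      show "((\<lambda>x. (1 + x) powr (1 - 2 * b) / (1 - 2 * b)) has_real_derivative (1 + x) powr (-2 * b)) (at x)"
      proof -
        have "((\<lambda>x. (1 + x) powr (1 - 2 * b)) has_real_derivative (1 - 2 * b) * (1 + x) powr (1 - 2 * b - 1)) (at x)"
          using x by (auto intro!: derivative_eq_intros)
        from DERIV_cdivide[OF this, of "1 - 2 * b"] show ?thesis using b by simp
      qed
      show "0 \<le> (1 + x) powr (-2 * b)" by simp
    next
      have "filterlim (\<lambda>x::real. 1 + x) at_top at_top"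
        by (intro filterlim_tendsto_add_at_top[OF tendsto_const] filterlim_ident)
      hence "((\<lambda>x. (1 + x) powr (1 - 2 * b)) \<longlongrightarrow> 0) at_top"
        using b by (intro tendsto_neg_powr) auto
      hence "((\<lambda>x. (1 + x) powr (1 - 2 * b) / (1 - 2 * b)) \<longlongrightarrow> 0 / (1 - 2 * b)) at_top"
        using b by (intro tendsto_intros) auto
      thus "((\<lambda>x. (1 + x) powr (1 - 2 * b) / (1 - 2 * b)) \<longlongrightarrow> 0) at_top" by simp
    qed measurable
    also have "\<dots> < \<infinity>" by simp
    finally have "(\<integral>\<^sup>+x. ennreal (q x) \<partial>lborel) < \<infinity>"
      by (simp add: q_def ennreal_mult ennreal_indicator)
    hence q: "integrable lborel q" by (intro integrableI_nonneg) (auto simp: q_def)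
    show "integrable lborel (\<lambda>x. q x + q (0 + (-1) * x))"
      by (intro Bochner_Integration.integrable_add q lborel_integrable_real_affine) auto
    show "AE x in lborel. norm (p x) \<le> norm (q x + q (0 + (-1) * x))"
      by (intro AE_I2) (auto simp: p_def q_def indicator_def)
  qed measurable
  show "integrable lborel (\<lambda>x. p x + (norm (f x))\<^sup>2)" using p f2 by simp
  have "s * r \<le> s\<^sup>2 + r\<^sup>2" if "s \<ge> 0" "r \<ge> 0" for s r :: real
  proof -
    have "2 * (s * r) \<le> s\<^sup>2 + r\<^sup>2" using sum_squares_bound[of s r] by (simp add: mult.assoc)
    thus ?thesis using mult_nonneg_nonneg[OF that] by linarith
  qed
  moreover have "((1 + \<bar>x\<bar>) powr (-b))\<^sup>2 = p x" for x
    unfolding p_def power2_eq_square by (simp flip: powr_add)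
  ultimately have "(1 + \<bar>x\<bar>) powr (-b) * norm (f x) \<le> p x + (norm (f x))\<^sup>2" for x
    by (metis norm_ge_zero powr_ge_zero)
  thus "AE x in lborel. norm ((1 + \<bar>x\<bar>) powr (-b) * norm (f x)) \<le> norm (p x + (norm (f x))\<^sup>2)"
    by (intro AE_I2) (simp add: p_def)
qed measurable

section \<open>Reduction to Borel functions and the final assembly\<close>

lemma completion_ex_borel_measurable_complex:
  fixes f :: "'a \<Rightarrow> complex"
  assumes f: "f \<in> borel_measurable (completion M)"
  obtains f' where "f' \<in> borel_measurable M" "AE x in M. f x = f' x"
proof -
  have "(\<lambda>x. Re (f x)) \<in> borel_measurable (completion M)" "(\<lambda>x. Im (f x)) \<in> borel_measurable (completion M)"
    using f by measurable
  then obtain u v where [measurable]: "u \<in> borel_measurable M" "v \<in> borel_measurable M"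
    and "AE x in M. Re (f x) = u x" "AE x in M. Im (f x) = v x"
    by (blast dest: completion_ex_borel_measurable_real)
  hence "AE x in M. f x = Complex (u x) (v x)"
    by (auto elim!: eventually_elim2 simp: complex_eq_iff)
  moreover have "(\<lambda>x. Complex (u x) (v x)) \<in> borel_measurable M" unfolding Complex_eq by measurable
  ultimately show ?thesis using that by blast
qed

text \<open>The conclusion is equality of functions, even for the chosen representative: every
  integral involved depends only on the almost everywhere class of f, so the two predicates
  \<open>has_L2_fourier f\<close> and \<open>has_L2_fourier f'\<close> coincide and the choice
  operator returns the same transform.\<close>

lemma fourier_cong_AE:
  assumes f: "f \<in> borel_measurable lebesgue" and f': "f' \<in> borel_measurable lebesgue"
    and ae: "AE x in lebesgue. f x = f' x"
  shows "fourier f = fourier f'"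
proof -
  have m: "(\<lambda>x. exp (- 2 * complex_of_real pi * \<i> * of_real x * of_real \<xi>)) \<in> borel_measurable lebesgue" for \<xi>
    by (intro measurable_completion) measurable
  have i: "(indicator {-R..R} :: real \<Rightarrow> real) \<in> borel_measurable lebesgue" for R
    by (intro measurable_completion) measurable
  have F: "fourier_integral u = fourier_integral v"
    if "u \<in> borel_measurable lebesgue" "v \<in> borel_measurable lebesgue" and uv: "AE x in lebesgue. u x = v x" for u v
  proof
    fix \<xi>
    show "fourier_integral u \<xi> = fourier_integral v \<xi>"
      unfolding fourier_integral_def using uv
      by (intro integral_cong_AE borel_measurable_times m that) (auto elim!: eventually_mono)
  qed
  have "fourier_integral (\<lambda>x. indicator {-R..R} x *\<^sub>R f x) = fourier_integral (\<lambda>x. indicator {-R..R} x *\<^sub>R f' x)" for R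
    using ae f f' i[of R] by (intro F borel_measurable_scaleR) (auto elim!: eventually_mono)
  hence "has_L2_fourier f = has_L2_fourier f'" unfolding has_L2_fourier_def fun_eq_iff by simp
  moreover have "integrable lebesgue f \<longleftrightarrow> integrable lebesgue f'"
    by (rule integrable_cong_AE[OF f f' ae])
  ultimately show ?thesis unfolding fourier_def using F[OF f f' ae] by simp
qed

theorem theorem3:
  fixes f :: "real \<Rightarrow> complex" and w :: complex
  assumes "integrable lebesgue f \<or> L2_fun f"
    and "Re w > -1"
    and "integrable lebesgue f \<or> Re w > -1/2"
  shows "integrable lebesgue (\<lambda>x. gen_binomial w (of_real x) * f x) \<and>
    (\<lambda>k::nat. gen_binomial w (of_nat k) *
        (LINT \<xi>:{-1/2..1/2}|lebesgue.
           fourier f \<xi> * exp (2 * of_real pi * \<i> * of_real \<xi> * of_nat k)))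
      sums (LINT x|lebesgue. gen_binomial w (of_real x) * f x)"
proof -
  note w = assms(2)
  have f: "f \<in> borel_measurable lebesgue" using assms(1) by (auto simp: L2_fun_def)
  then obtain u where u [measurable]: "u \<in> borel_measurable lborel" and "AE x in lborel. f x = u x"
    by (rule completion_ex_borel_measurable_complex)
  hence ae: "AE x in lebesgue. f x = u x" by (intro AE_completion)
  have u': "u \<in> borel_measurable lebesgue" by (intro measurable_completion) measurable
  have L1: "integrable lebesgue f \<longleftrightarrow> integrable lborel u"
    using integrable_cong_AE[OF f u' ae] integrable_completion[OF u] by simp
  have L2: "integrable lborel (\<lambda>x. (norm (u x))\<^sup>2)" if "\<not> integrable lborel u"
  proof -
    have "integrable lebesgue (\<lambda>x. (norm (f x))\<^sup>2)" using that assms(1) L1 by (simp add: L2_fun_def)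
    moreover have "integrable lebesgue (\<lambda>x. (norm (f x))\<^sup>2) = integrable lebesgue (\<lambda>x. (norm (u x))\<^sup>2)"
      using f u' ae by (intro integrable_cong_AE borel_measurable_power borel_measurable_norm) (auto elim!: eventually_mono)
    ultimately show ?thesis by (simp add: integrable_completion)
  qed
  obtain b where b: "0 \<le> b" "b < Re w + 1" "b < 1"
    and int: "integrable lborel (\<lambda>x. (1 + \<bar>x\<bar>) powr (-b) * norm (u x))"
  proof (cases "integrable lborel u")
    case True
    thus ?thesis using w by (intro that[of 0]) (auto simp: add_nonneg_eq_0_iff)
  next
    case False
    hence "1/2 < min (Re w + 1) 1" using assms(3) L1 by auto
    then obtain b where "1/2 < b" "b < min (Re w + 1) 1" using dense by blast
    thus ?thesis using integrable_L2_times_powr[OF _ L2[OF False]] by (intro that[of b]) auto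
  qed
  have ub: "u \<in> borel_measurable borel" by measurable
  note main = sums_integral_gen_binomial[OF w b ub int]
  have band: "(LINT \<xi>|lebesgue. fourier f \<xi> * unit_band_character (real k) \<xi>) =
      (LINT x|lborel. u x * of_real (normalized_sinc (x - real k)))" for k
  proof (cases "integrable lborel u")
    case True
    thus ?thesis unfolding fourier_cong_AE[OF f u' ae]
      using integral_fourier_integral_unit_band[OF True] by (simp add: fourier_def integrable_completion)
  next
    case False
    have "has_L2_fourier u (SOME g. has_L2_fourier u g)"
      using has_L2_fourier_exists[OF ub L2[OF False]] by (rule someI_ex)
    hence "has_L2_fourier u (fourier f)"
      using False unfolding fourier_cong_AE[OF f u' ae] by (simp add: fourier_def integrable_completion)
    thus ?thesis by (rule integral_L2_fourier_unit_band[OF ub L2[OF False] _ main(1)])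
  qed
  have gb: "(\<lambda>x. gen_binomial w (complex_of_real x)) \<in> borel_measurable lebesgue"
    by (intro measurable_completion) measurable
  have ae': "AE x in lebesgue. gen_binomial w (of_real x) * f x = gen_binomial w (of_real x) * u x"
    using ae by eventually_elim simp
  have "integrable lebesgue (\<lambda>x. gen_binomial w (of_real x) * f x) =
      integrable lebesgue (\<lambda>x. gen_binomial w (of_real x) * u x)"
    by (intro integrable_cong_AE borel_measurable_times gb f u' ae')
  also have "\<dots> = integrable lborel (\<lambda>x. gen_binomial w (of_real x) * u x)"
    by (intro integrable_completion) measurable
  finally have 1: "integrable lebesgue (\<lambda>x. gen_binomial w (of_real x) * f x)" using main(2) by simp
  have "(LINT x|lebesgue. gen_binomial w (of_real x) * f x) = (LINT x|lebesgue. gen_binomial w (of_real x) * u x)"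
    by (intro integral_cong_AE borel_measurable_times gb f u' ae')
  also have "\<dots> = (LINT x|lborel. gen_binomial w (of_real x) * u x)"
    by (intro integral_completion) measurable
  finally have "(\<lambda>k::nat. gen_binomial w (of_nat k) *
        (LINT \<xi>:{-1/2..1/2}|lebesgue.
           fourier f \<xi> * exp (2 * of_real pi * \<i> * of_real \<xi> * of_nat k)))
      sums (LINT x|lebesgue. gen_binomial w (of_real x) * f x)"
    using main(3) unfolding set_integral_unit_band band gen_binomial_of_nat[OF w] by simp
  with 1 show ?thesis ..
qed

end
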